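(* Let $\ell$ be a positive integer. For integers $0\le j\le m$ and real $x$ define $$z_\ell(m,j)(x)=2\,\mathrm{Re}\int_0^\infty(\ell+iu)^{m-j}\zeta(2\ell+1-j,\ell+iu)\log\left(1+\frac{u^2}{(x-\ell)^2}\right)du,$$ $$Z_\ell(m,j)(x)=2\,\mathrm{Re}\int_0^\infty\left(\ell+\tfrac12+iu\right)^{m-j}\zeta\!\left(2\ell+2-j,\ell+\tfrac12+iu\right)\log\left(1+\frac{u^2}{(x-\ell-\frac12)^2}\right)du.$$ Then for $x>\ell$, $$\sum_{j=0}^{2\ell-1}(-1)^{j-1}\sum_{m=j}^{2\ell-1}\binom{m}{j}s(2\ell,m+1)\,z_\ell(m,j)(x)=-\frac{\pi}{\ell}\left(\log(x-\ell)+H_{2\ell-1}-\frac{d^{2\ell-1}}{dx^{2\ell-1}}\left\{\binom{x-1}{2\ell-1}\psi(x-\ell)\right\}\right),$$ and for $x>\ell+\frac12$, $$\sum_{j=0}^{2\ell}(-1)^{j}\sum_{m=j}^{2\ell}\binom{m}{j}s(2\ell+1,m+1)\,Z_\ell(m,j)(x)=-\frac{2\pi}{2\ell+1}\left(\log\left(x-\ell-\tfrac12\right)+H_{2\ell}-\frac{d^{2\ell}}{dx^{2\ell}}\left\{\binom{x-1}{2\ell}\psi(x-\ell)\right\}\right).$$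
   Context: $\zeta(s,w)=\sum_{n\ge0}(n+w)^{-s}$ is the Hurwitz zeta function; $s(n,k)$ are the (signed) Stirling numbers of the first kind, defined by $x(x-1)\cdots(x-n+1)=\sum_k s(n,k)x^k$; $H_n$ is the $n$-th harmonic number; $\psi=\Gamma'/\Gamma$ is the digamma function; $\binom{x}{n}=\frac{x(x-1)\cdots(x-n+1)}{n!}$.
   Formalization: The real part is taken inside the integrals defining z_ℓ(m,j) and Z_ℓ(m,j), because for the top index (m=2ℓ−1, resp. m=2ℓ) the imaginary part of the integrand decays only like log(u)/u and the complex integral diverges; where it converges the two agree. *)

theory Defs
  imports "HOL-Analysis.Analysis" "HOL-Combinatorics.Stirling"
begin

text \<open>Hurwitz zeta function zeta(s,w) = sum over n of (n+w) to the power -s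
  (principal branch); used here only for Re s > 1 and Re w > 0.\<close>
definition hurwitz_zeta :: "complex \<Rightarrow> complex \<Rightarrow> complex" where
  "hurwitz_zeta s w = (\<Sum>n. (of_nat n + w) powr (- s))"

definition stirling1s :: "nat \<Rightarrow> nat \<Rightarrow> int" where
  "stirling1s n k = (-1) ^ (n - k) * int (stirling n k)"

definition zl :: "nat \<Rightarrow> nat \<Rightarrow> nat \<Rightarrow> real \<Rightarrow> real" where
  "zl l m j x = 2 * integral {0..} (\<lambda>u::real.
      Re ((of_nat l + \<i> * of_real u) ^ (m - j) *
          hurwitz_zeta (of_nat (2*l + 1 - j)) (of_nat l + \<i> * of_real u)) *
      ln (1 + u^2 / (x - real l)^2))"

definition Zl :: "nat \<Rightarrow> nat \<Rightarrow> nat \<Rightarrow> real \<Rightarrow> real" where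
  "Zl l m j x = 2 * integral {0..} (\<lambda>u::real.
      Re ((of_real (real l + 1/2) + \<i> * of_real u) ^ (m - j) *
          hurwitz_zeta (of_nat (2*l + 2 - j)) (of_real (real l + 1/2) + \<i> * of_real u)) *
      ln (1 + u^2 / (x - real l - 1/2)^2))"

end

(* Write w = c + iu, a = x - c, L(u) = ln (1 + u^2 / a^2) and P(n) = (n+1)(n+2)...(n+K), where
   (K, c) is (2l - 1, l) or (2l, l + 1/2).  Expanding (w - (n + w))^m = (-n)^m, the double sum over
   j and m collapses to the single series of P(n) (n + w)^(-K-2).
   Termwise, 1/(n + w)^(K+2) integrated against L gives - pi/(K+1) (n + x)^(-K-1), but series and
   integral must not be interchanged: the result would diverge logarithmically.  One therefore
   subtracts the integral over t > 0 of t^K (t + w)^(-K-2), which equals 1/((K+1) w).  The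
   difference converges absolutely, so Fubini applies on the quarter plane (t, u), and the
   subtracted term is covered by the explicit integral of Re (1/w) L.
   What remains is the limit of ln N - sum_{n<N} P(n) (n + x)^(-K-1).  It is the K-th derivative of
   binom(x-1, K) psi(x - l), by the Leibniz rule, the series for the polygamma functions and the
   Taylor formula for the polynomial binom(x-1, K). *)

theory Submission
  imports Defs
begin

section \<open>Integrals over the half line\<close>

text \<open>Termwise absolute values of the series sum to size 1/|w|, and 1/u times L is not
  integrable at infinity; this is the obstacle to Fubini. Even the summed series is of size 1/|w|,
  being close to 1/((K+1) w). Only the real part of 1/w, c/|w|^2, decays fast enough, so real parts
  are taken before any final bound in u. Subtracting the t-integral piece by piece over [n, n+1]
  leaves differences of order |n+w|^(-3). The exponent 3 is split as 5/4 for t and 7/4 for u; L is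
  at most a constant times (1+u)^(1/2), which leaves 5/4 > 1 in both variables. Writing the series
  as an integral of a function of \<open>nat \<lfloor>t\<rfloor>\<close> puts sum and comparison
  integral into one integrand. Origin of the constants: t^K/(t+x)^(K+1) has the primitive ln(t+x)
  minus the sum over j = 1..K of (t/(t+x))^j/j, which yields the harmonic number at infinity and ln
  x at 0. The integral of Re (1/w) L contributes ln(1+c/a) = ln x - ln a, which turns ln x into ln
  a.\<close>

text \<open>Integrability and value travel together, so linear combinations follow by rules alone.
  The integral is Lebesgue's, as Fubini requires; \<open>has_halfline_integral_integral\<close>
  links it to the gauge \<open>integral\<close> in \<open>zl\<close> and \<open>Zl\<close>.\<close>

definition has_halfline_integral :: "(real \<Rightarrow> real) \<Rightarrow> real \<Rightarrow> bool" where
  "has_halfline_integral f v \<longleftrightarrow> set_integrable lborel {0..} f \<and> (LBINT u:{0..}. f u) = v"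

abbreviation cx :: "real \<Rightarrow> real \<Rightarrow> complex" where
  "cx y u \<equiv> complex_of_real y + \<i> * complex_of_real u"

lemma has_halfline_integral_add: "has_halfline_integral f a \<Longrightarrow> has_halfline_integral g b \<Longrightarrow> has_halfline_integral (\<lambda>u. f u + g u) (a + b)"
  by (auto simp: has_halfline_integral_def)

lemma has_halfline_integral_diff: "has_halfline_integral f a \<Longrightarrow> has_halfline_integral g b \<Longrightarrow> has_halfline_integral (\<lambda>u. f u - g u) (a - b)"
  by (auto simp: has_halfline_integral_def)

lemma has_halfline_integral_cmult: "has_halfline_integral f a \<Longrightarrow> has_halfline_integral (\<lambda>u. c * f u) (c * a)"
  by (auto simp: has_halfline_integral_def)

lemma has_halfline_integral_cong:
  assumes "has_halfline_integral f a" "\<And>u. u \<ge> 0 \<Longrightarrow> f u = g u"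
  shows "has_halfline_integral g a"
proof -
  have "set_integrable lborel {0..} f \<longleftrightarrow> set_integrable lborel {0..} g"
    by (rule set_integrable_cong) (use assms in auto)
  moreover have "(LBINT u:{0..}. f u) = (LBINT u:{0..}. g u)"
    by (rule set_lebesgue_integral_cong) (use assms in auto)
  ultimately show ?thesis using assms(1) by (simp add: has_halfline_integral_def)
qed

lemma has_halfline_integral_sum:
  assumes "finite A" "\<And>i. i \<in> A \<Longrightarrow> has_halfline_integral (f i) (v i)"
  shows "has_halfline_integral (\<lambda>u. \<Sum>i\<in>A. f i u) (\<Sum>i\<in>A. v i)"
  using assms
proof (induction A rule: finite_induct)
  case empty
  then show ?case by (simp add: has_halfline_integral_def set_integrable_def)
next
  case (insert x A)
  then show ?case by (simp add: has_halfline_integral_add)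
qed

lemma has_halfline_integral_integral: "set_integrable lborel {0..} f \<Longrightarrow> has_halfline_integral f (integral {0..} f)"
  by (auto simp: has_halfline_integral_def set_borel_integral_eq_integral)

lemma has_halfline_integral_unique: "has_halfline_integral f v \<Longrightarrow> has_halfline_integral f w \<Longrightarrow> v = w"
  by (auto simp: has_halfline_integral_def)

section \<open>Integrability from power decay, and the fundamental theorem on the half line\<close>

lemma set_integrable_powr:
  fixes p :: real
  assumes "p > 1"
  shows "set_integrable lborel {0..} (\<lambda>u. (1 + u) powr (-p))"
  unfolding set_integrable_def
proof (rule integrableI_nonneg)
  have d: "((\<lambda>u. (1 + u) powr (1 - p) / (1 - p)) has_real_derivative (1 + u) powr (-p)) (at u)"
    if "u \<ge> 0" for u
    using that assms by (auto intro!: derivative_eq_intros)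
  have l: "((\<lambda>u. (1 + u) powr (1 - p) / (1 - p)) \<longlongrightarrow> 0 / (1 - p)) at_top"
    by (intro tendsto_intros tendsto_neg_powr)
      (use assms in \<open>auto intro!: filterlim_tendsto_add_at_top filterlim_ident\<close>)
  have "(\<integral>\<^sup>+u. ennreal ((1 + u) powr (-p)) * indicator {0..} u \<partial>lborel)
     = 0 / (1 - p) - (1 + 0) powr (1 - p) / (1 - p)"
    by (rule nn_integral_FTC_atLeast[OF _ _ _ l]) (use d in auto)
  then show "(\<integral>\<^sup>+u. ennreal (indicat_real {0..} u *\<^sub>R (1 + u) powr (-p)) \<partial>lborel) < \<infinity>"
    by (simp add: indicator_mult_ennreal mult.commute)
qed (auto)

lemma set_integrable_powr_bound:
  fixes f :: "real \<Rightarrow> real"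
  assumes "f \<in> borel_measurable borel" "p > 1"
    and "\<And>u. u \<ge> 0 \<Longrightarrow> \<bar>f u\<bar> \<le> C * (1 + u) powr (-p)"
  shows "set_integrable lborel {0..} f"
proof -
  have "set_integrable lborel {0..} (\<lambda>u. C * (1 + u) powr (-p))"
    using set_integrable_powr[OF assms(2)] by simp
  then show ?thesis
    unfolding set_integrable_def
    by (rule Bochner_Integration.integrable_bound)
       (use assms in \<open>auto simp: indicator_def intro!: AE_I2 order_trans[OF assms(3)]\<close>)
qed

lemma tendsto_integral_half_line:
  fixes f :: "real \<Rightarrow> real"
  assumes "set_integrable lborel {0..} f"
  shows "((\<lambda>b. integral {0..b} f) \<longlongrightarrow> (LBINT u:{0..}. f u)) at_top"
proof -
  have "((\<lambda>b. LBINT u:{0..b}. f u) \<longlongrightarrow> (LBINT u:{0..}. f u)) at_top"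
    by (rule tendsto_set_lebesgue_integral_at_top) (use assms in auto)
  moreover have "(LBINT u:{0..b}. f u) = integral {0..b} f" for b
    by (intro set_borel_integral_eq_integral set_integrable_subset[OF assms]) auto
  ultimately show ?thesis by simp
qed

text \<open>The integrand may change sign, so integrability is a separate hypothesis. The integrals
  over [0,b] equal \<open>F b - F 0\<close>, and their limit is also the Lebesgue integral.\<close>

lemma has_halfline_integral_FTC:
  fixes f F :: "real \<Rightarrow> real"
  assumes "set_integrable lborel {0..} f"
    and "\<And>u. u \<ge> 0 \<Longrightarrow> (F has_real_derivative f u) (at u within {0..})"
    and "(F \<longlongrightarrow> m) at_top"
  shows "has_halfline_integral f (m - F 0)"
proof -
  have "((\<lambda>b. integral {0..b} f) \<longlongrightarrow> m - F 0) at_top"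
  proof (rule Lim_transform_eventually)
    show "((\<lambda>b. F b - F 0) \<longlongrightarrow> m - F 0) at_top"
      by (intro tendsto_intros assms)
    show "\<forall>\<^sub>F b in at_top. F b - F 0 = integral {0..b} f"
      using eventually_ge_at_top[of 0]
    proof eventually_elim
      case (elim b)
      have "(f has_integral (F b - F 0)) {0..b}"
        by (rule fundamental_theorem_of_calculus)
           (use elim in \<open>auto simp flip: has_real_derivative_iff_has_vector_derivative
              intro!: DERIV_subset[OF assms(2)]\<close>)
      then show ?case by (simp add: integral_unique)
    qed
  qed
  with tendsto_integral_half_line[OF assms(1)] have "(LBINT u:{0..}. f u) = m - F 0"
    using tendsto_unique trivial_limit_at_top_linorder by blast
  with assms(1) show ?thesis by (simp add: has_halfline_integral_def)
qed

text \<open>The argument of the logarithm is at most ((1 + 1/a)(1 + u))^2, and ln v = 2 ln (sqrt v)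
  <= 2 sqrt v for v = 1 + u; this accounts for the constant 4. The power 1/2 is small enough to be
  afforded by a decay of order 7/4.\<close>

lemma ln_quadratic_le:
  fixes a :: real
  assumes "a > 0"
  shows "\<exists>C\<ge>0. \<forall>u\<ge>0. \<bar>ln (1 + u^2 / a^2)\<bar> \<le> C * (1 + u) powr (1/2)"
proof (intro exI conjI allI impI)
  show "2 * ln (1 + 1/a) + 4 \<ge> 0" using assms by (simp add: add_nonneg_nonneg)
  fix u :: real assume u: "u \<ge> 0"
  have "1 + u^2/a^2 \<le> ((1 + 1/a) * (1 + u))^2"
  proof -
    have "((1 + 1/a) * (1 + u))^2 = 1 + u^2/a^2 + (1/a^2 + u^2 + 2 * (1/a) + 2*u + 2 * (u^2 / a) + 2 * u / a^2 + 4 * u / a)"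
      using assms by (simp add: field_simps power2_eq_square)
    moreover have "1/a^2 + u^2 + 2 * (1/a) + 2*u + 2 * (u^2 / a) + 2 * u / a^2 + 4 * u / a \<ge> 0"
      using u assms by (intro add_nonneg_nonneg) auto
    ultimately show ?thesis by linarith
  qed
  moreover have "1 + u^2/a^2 > 0" by (simp add: add_pos_nonneg)
  ultimately have "ln (1 + u^2/a^2) \<le> ln (((1 + 1/a) * (1 + u))^2)" by (rule ln_mono)
  also have "\<dots> = 2 * ln (1 + 1/a) + 2 * ln (1 + u)"
  proof -
    have "1 + 1/a > 0" using assms by (simp add: add_pos_pos)
    then show ?thesis using u by (subst ln_realpow) (auto simp: ln_mult)
  qed
  finally have 1: "ln (1 + u^2/a^2) \<le> 2 * ln (1 + 1/a) + 2 * ln (1 + u)" .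
  have "ln (1 + u) = 2 * ln (sqrt (1 + u))" using u by (simp add: ln_sqrt)
  also have "\<dots> \<le> 2 * (sqrt (1 + u) - 1)" using u ln_le_minus_one[of "sqrt (1+u)"] by simp
  finally have 2: "ln (1 + u) \<le> 2 * sqrt (1 + u)" by simp
  have "2 * ln (1 + 1/a) * 1 \<le> 2 * ln (1 + 1/a) * sqrt (1 + u)"
    using u assms by (intro mult_left_mono) auto
  with 1 2 have "ln (1 + u^2/a^2) \<le> (2 * ln (1 + 1/a) + 4) * sqrt (1 + u)"
    by (simp add: algebra_simps)
  moreover have "ln (1 + u^2/a^2) \<ge> 0" by simp
  ultimately show "\<bar>ln (1 + u^2 / a^2)\<bar> \<le> (2 * ln (1 + 1/a) + 4) * (1 + u) powr (1/2)"
    using u by (simp add: powr_half_sqrt)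
qed

section \<open>Integrals of powers against the logarithm\<close>

lemma norm_cx_ge: "u \<ge> 0 \<Longrightarrow> y > 0 \<Longrightarrow> y \<le> norm (cx y u)" "u \<ge> 0 \<Longrightarrow> y > 0 \<Longrightarrow> u \<le> norm (cx y u)"
  using abs_Re_le_cmod[of "cx y u"] abs_Im_le_cmod[of "cx y u"] by auto

text \<open>Both \<open>y\<close> and \<open>u\<close> are at most \<open>norm (cx y u)\<close>;
  adding the first bound to \<open>y\<close> times the second gives the constant.\<close>

lemma norm_inverse_cx_le:
  assumes "u \<ge> 0" "y > 0"
  shows "norm (1 / cx y u) \<le> ((1 + y) / y) / (1 + u)"
proof -
  have "y * u \<le> y * norm (cx y u)" using norm_cx_ge[of u y] assms by (intro mult_left_mono) auto
  then have "y * (1 + u) \<le> (1 + y) * norm (cx y u)"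
    using norm_cx_ge(1)[of u y] assms unfolding distrib_left distrib_right by linarith
  moreover have "norm (cx y u) > 0" using norm_cx_ge(1)[of u y] assms by linarith
  moreover have "0 < y * (1 + u)" using assms by simp
  ultimately have "1 / norm (cx y u) \<le> (1 + y) / (y * (1 + u))"
    by (simp add: le_divide_eq divide_le_eq)
  then show ?thesis by (simp add: norm_divide)
qed

lemma cx_nonzero [simp]: "y > 0 \<Longrightarrow> cx y u \<noteq> 0"
  by (auto simp: complex_eq_iff)

lemma Re_cx_deriv:
  assumes "(f has_field_derivative f') (at (cx y u))"
  shows "((\<lambda>u. Re (f (cx y u))) has_real_derivative Re (\<i> * f')) (at u)"
proof -
  have "(cx y has_vector_derivative \<i>) (at u)"
    unfolding has_vector_derivative_complex_iff by (auto intro!: derivative_eq_intros)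
  from field_vector_diff_chain_at[OF this assms] show ?thesis
    by (auto simp: o_def intro!: derivative_eq_intros)
qed

lemma powr_bound_of_power2:
  fixes u p :: real
  assumes "u \<ge> 0" "p \<le> 2"
  shows "1 / (1 + u)^2 \<le> (1 + u) powr (-p)"
proof -
  have "1 / (1+u)^2 = (1 + u) powr (-2)"
    using assms by (simp add: powr_minus powr_numeral divide_inverse)
  also have "\<dots> \<le> (1 + u) powr (-p)"
    using assms by (intro powr_mono) auto
  finally show ?thesis .
qed

lemma set_integrable_inverse_square_bound:
  fixes f :: "real \<Rightarrow> real"
  assumes "f \<in> borel_measurable borel"
    and "\<And>u. u \<ge> 0 \<Longrightarrow> \<bar>f u\<bar> \<le> C / (1 + u)^2"
  shows "set_integrable lborel {0..} f"
proof (rule set_integrable_powr_bound[OF assms(1), of 2 C])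
  fix u :: real assume "u \<ge> 0"
  then show "\<bar>f u\<bar> \<le> C * (1 + u) powr -2"
    using assms(2)[of u] by (simp add: powr_minus powr_numeral divide_inverse)
qed simp

text \<open>The logarithm costs 1/2 of the exponent 7/4; the remaining 5/4 still exceeds 1.\<close>

lemma set_integrable_mult_ln:
  fixes f :: "real \<Rightarrow> real"
  assumes "f \<in> borel_measurable borel" "a > 0"
    and "\<And>u. u \<ge> 0 \<Longrightarrow> \<bar>f u\<bar> \<le> C * (1 + u) powr (-7/4)"
  shows "set_integrable lborel {0..} (\<lambda>u. f u * ln (1 + u^2 / a^2))"
proof -
  obtain D where D: "D \<ge> 0" "\<And>u. u \<ge> 0 \<Longrightarrow> \<bar>ln (1 + u^2 / a^2)\<bar> \<le> D * (1 + u) powr (1/2)"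
    using ln_quadratic_le[OF assms(2)] by blast
  show ?thesis
  proof (rule set_integrable_powr_bound[of _ "5/4" "C * D"])
    show "(\<lambda>u. f u * ln (1 + u^2 / a^2)) \<in> borel_measurable borel"
      using assms(1) by measurable
    fix u :: real assume u: "u \<ge> 0"
    have "\<bar>f u * ln (1 + u^2 / a^2)\<bar> \<le> (C * (1 + u) powr (-7/4)) * (D * (1 + u) powr (1/2))"
      unfolding abs_mult by (intro mult_mono D assms u order_trans[OF _ assms(3)]) auto
    also have "\<dots> = C * D * ((1 + u) powr (-7/4) * (1 + u) powr (1/2))" by simp
    also have "(1 + u) powr (-7/4) * (1 + u) powr (1/2) = (1 + u) powr (-(5/4))"
      by (simp flip: powr_add)
    finally show "\<bar>f u * ln (1 + u^2 / a^2)\<bar> \<le> C * D * (1 + u) powr (-(5/4))" .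
  qed simp
qed

lemma norm_inverse_cx_power_le:
  assumes "u \<ge> 0" "y > 0"
  shows "norm (1 / cx y u ^ (k + 2)) \<le> ((1 + y) / y)^2 * (1 / y)^k / (1 + u)^2"
proof -
  have "norm (1 / cx y u) \<le> 1 / y"
    using norm_cx_ge(1)[OF assms] assms
    by (simp add: norm_divide frac_le)
  then have "norm (1 / cx y u)^k * norm (1 / cx y u)^2 \<le> (1 / y)^k * (((1 + y) / y) / (1 + u))^2"
    by (intro mult_mono power_mono norm_inverse_cx_le assms) (use assms in auto)
  moreover have "norm (1 / cx y u)^k * norm (1 / cx y u)^2 = norm (1 / cx y u ^ (k + 2))"
    by (simp add: norm_divide norm_power norm_mult power_divide power2_eq_square mult_ac)
  ultimately show ?thesis by (simp only: power_divide mult.commute times_divide_eq_right)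
qed

lemma set_integrable_Re_power:
  assumes "y > 0"
  shows "set_integrable lborel {0..} (\<lambda>u. Re (1 / cx y u ^ (k + 2)))"
proof (rule set_integrable_inverse_square_bound[of _ "((1 + y) / y)^2 * (1 / y)^k"])
  show "\<bar>Re (1 / cx y u ^ (k + 2))\<bar> \<le> ((1 + y) / y)^2 * (1 / y)^k / (1 + u)^2" if "u \<ge> 0" for u
    using abs_Re_le_cmod[of "1 / cx y u ^ (k + 2)"] norm_inverse_cx_power_le[OF that assms, of k] by linarith
qed measurable

lemma tendsto_inverse_cx:
  assumes "y > 0"
  shows "((\<lambda>u. 1 / cx y u) \<longlongrightarrow> 0) at_top"
proof (rule Lim_null_comparison)
  show "\<forall>\<^sub>F u in at_top. norm (1 / cx y u) \<le> ((1 + y) / y) / (1 + u)"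
    using eventually_ge_at_top[of 0] by eventually_elim (use norm_inverse_cx_le assms in blast)
  show "((\<lambda>u. ((1 + y) / y) / (1 + u)) \<longlongrightarrow> 0) at_top"
    by (intro tendsto_divide_0[OF tendsto_const] filterlim_at_top_imp_at_infinity
      filterlim_tendsto_add_at_top[OF tendsto_const] filterlim_ident)
qed

lemma tendsto_inverse_cx_power:
  assumes "y > 0" "k > 0"
  shows "((\<lambda>u. 1 / cx y u ^ k) \<longlongrightarrow> 0) at_top"
  using tendsto_power[OF tendsto_inverse_cx[OF assms(1)], of k] assms(2)
  by (simp add: power_divide power_0_left)

lemma has_field_derivative_inverse_power:
  fixes z :: "'a :: real_normed_field"
  assumes "z \<noteq> 0"
  shows "((\<lambda>z. 1 / z ^ k) has_field_derivative - of_nat k / z ^ (k + 1)) (at z within S)"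
proof -
  have "z * z ^ (k - Suc 0) = z ^ k" if "k > 0"
    using that by (simp flip: power_Suc)
  then show ?thesis using assms
    by (cases "k = 0") (auto intro!: derivative_eq_intros simp: field_simps)
qed

text \<open>With w = y + iu one has dw = i du, so i/((k+1) w^(k+1)) is a primitive. It tends to 0 at
  infinity and is purely imaginary at u = 0, so its real part vanishes at both ends.\<close>

lemma has_halfline_integral_Re_power:
  assumes "y > 0"
  shows "has_halfline_integral (\<lambda>u. Re (1 / cx y u ^ (k + 2))) 0"
proof -
  define F where "F = (\<lambda>u. Re (\<i> / of_nat (k+1) * (1 / cx y u ^ (k+1))))"
  have "has_halfline_integral (\<lambda>u. Re (1 / cx y u ^ (k + 2))) (0 - F 0)"
  proof (rule has_halfline_integral_FTC)
    show "set_integrable lborel {0..} (\<lambda>u. Re (1 / cx y u ^ (k + 2)))"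
      by (rule set_integrable_Re_power[OF assms])
    show "(F has_real_derivative Re (1 / cx y u ^ (k + 2))) (at u within {0..})" for u
    proof -
      have "((\<lambda>z. \<i> / of_nat (k+1) * (1 / z ^ (k+1))) has_field_derivative
          \<i> / of_nat (k+1) * (- of_nat (k+1) / cx y u ^ (k+1+1))) (at (cx y u))"
        by (intro DERIV_cmult has_field_derivative_inverse_power) (use assms in auto)
      from Re_cx_deriv[OF this] show ?thesis
        unfolding F_def by (auto intro: has_field_derivative_at_within simp: field_simps simp del: of_nat_Suc)
    qed
    have "((\<lambda>u. Re (\<i> / of_nat (k+1) * (1 / cx y u ^ (k+1)))) \<longlongrightarrow> Re (\<i> / of_nat (k+1) * 0)) at_top"
      by (intro tendsto_intros tendsto_inverse_cx_power) (use assms in auto)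
    then show "(F \<longlongrightarrow> 0) at_top" by (simp add: F_def)
  qed
  moreover have "F 0 = 0"
  proof -
    have "\<i> / of_nat (k+1) * (1 / cx y 0 ^ (k+1)) = \<i> * of_real (1 / ((k+1) * y^(k+1)))" by simp
    then show ?thesis unfolding F_def by (simp only: Re_i_times Im_complex_of_real)
  qed
  ultimately show ?thesis by simp
qed

lemma Re_inverse_cx: "Re (1 / cx y u) = y / (y^2 + u^2)"
  by (simp add: Re_divide)

lemma tendsto_arctan_div:
  assumes "y > 0"
  shows "((\<lambda>u. arctan (u / y)) \<longlongrightarrow> pi / 2) at_top"
proof (rule filterlim_compose[OF tendsto_arctan_at_top])
  have "LIM u at_top. (1 / y) * u :> at_top"
    by (rule filterlim_tendsto_pos_mult_at_top[OF tendsto_const]) (use assms in \<open>auto intro: filterlim_ident\<close>)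
  then show "LIM u at_top. u / y :> at_top" by simp
qed

text \<open>The gain over \<open>norm_inverse_cx_le\<close> comes from taking the real part: Re
  (1/w) = y/|w|^2 is quadratically small, although 1/w is not.\<close>

lemma abs_Re_inverse_cx_le:
  assumes "u \<ge> 0" "y > 0"
  shows "\<bar>Re (1 / cx y u)\<bar> \<le> y * ((1 + y) / y)^2 / (1 + u)^2"
proof -
  have "norm (1 / cx y u) ^ 2 \<le> (((1 + y) / y) / (1 + u))^2"
    by (intro power_mono norm_inverse_cx_le assms) auto
  moreover have "norm (cx y u) ^ 2 = y^2 + u^2" by (simp add: cmod_power2)
  ultimately have "1 / (y^2 + u^2) \<le> (((1 + y) / y) / (1 + u))^2"
    by (simp add: norm_divide power_divide)
  then have "y * (1 / (y^2 + u^2)) \<le> y * (((1 + y) / y) / (1 + u))^2"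
    using assms by (intro mult_left_mono) auto
  then show ?thesis
    unfolding Re_inverse_cx using assms by (simp add: power_divide power_mult_distrib)
qed

lemma has_halfline_integral_Re_inverse:
  assumes "y > 0"
  shows "has_halfline_integral (\<lambda>u. Re (1 / cx y u)) (pi / 2)"
proof -
  have "has_halfline_integral (\<lambda>u. Re (1 / cx y u)) (pi / 2 - arctan (0 / y))"
  proof (rule has_halfline_integral_FTC[OF _ _ tendsto_arctan_div[OF assms]])
    show "((\<lambda>u. arctan (u / y)) has_real_derivative Re (1 / cx y u)) (at u within {0..})" for u
      unfolding Re_inverse_cx using assms
      by (auto intro!: derivative_eq_intros simp: field_simps power2_eq_square add_nonneg_eq_0_iff)
    show "set_integrable lborel {0..} (\<lambda>u. Re (1 / cx y u))"
      by (rule set_integrable_inverse_square_bound[of _ "y * ((1 + y) / y)^2"])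
        (use abs_Re_inverse_cx_le assms in auto)
  qed
  then show ?thesis by simp
qed

text \<open>Since \<open>Y = y + iu\<close> and \<open>A = a - iu\<close> have the constant sum \<open>y + a\<close>,
  \<open>1 / (Y A) = (1 / Y + 1 / A) / (y + a)\<close>, which reduces the exponent of \<open>Y\<close>.\<close>

lemma has_halfline_integral_cross_cnj:
  assumes "y > 0" "a > 0"
  shows "has_halfline_integral (\<lambda>u. Re (1 / (cx y u ^ (k+1) * cx a (-u)))) (pi / (y + a) ^ (k+1))"
proof (induction k)
  case 0
  have "has_halfline_integral (\<lambda>u. 1 / (y+a) * (Re (1 / cx y u) + Re (1 / cx a u))) (1 / (y+a) * (pi/2 + pi/2))"
    by (intro has_halfline_integral_cmult has_halfline_integral_add has_halfline_integral_Re_inverse assms)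
  then have "has_halfline_integral (\<lambda>u. Re (1 / (cx y u * cx a (-u)))) (1 / (y+a) * (pi/2 + pi/2))"
  proof (rule has_halfline_integral_cong)
    fix u :: real
    have "1 / (cx y u * cx a (-u)) = (1 / cx y u + 1 / cx a (-u)) / (cx y u + cx a (-u))"
    proof -
      have "Y \<noteq> 0 \<Longrightarrow> A \<noteq> 0 \<Longrightarrow> Y + A \<noteq> 0 \<Longrightarrow> 1 / (Y * A) = (1 / Y + 1 / A) / (Y + A)" for Y A :: complex
        by (simp add: divide_simps)
      moreover have "cx y u + cx a (-u) \<noteq> 0" using assms by (simp add: complex_eq_iff)
      ultimately show ?thesis
        using cx_nonzero[OF assms(2), of "-u"] cx_nonzero[OF assms(1), of u] by blast
    qed
    also have "cx y u + cx a (-u) = of_real (y + a)" by simp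
    finally have "Re (1 / (cx y u * cx a (-u))) = (Re (1 / cx y u) + Re (1 / cx a (-u))) / (y + a)"
      by (simp only: Re_divide_of_real plus_complex.sel)
    also have "Re (1 / cx a (-u)) = Re (1 / cx a u)" by (simp only: Re_inverse_cx power2_minus)
    finally show "1 / (y+a) * (Re (1 / cx y u) + Re (1 / cx a u)) = Re (1 / (cx y u * cx a (-u)))"
      by simp
  qed
  then show ?case by simp
next
  case (Suc k)
  \<comment> \<open>The pure power of Y integrates to 0, so each step merely divides the value by
    \<open>y + a\<close>.\<close>
  have "has_halfline_integral (\<lambda>u. 1 / (y+a) * (Re (1 / cx y u ^ (k+2)) + Re (1 / (cx y u ^ (k+1) * cx a (-u)))))
      (1 / (y+a) * (0 + pi / (y + a) ^ (k+1)))"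
    by (intro has_halfline_integral_cmult has_halfline_integral_add has_halfline_integral_Re_power assms Suc)
  then have "has_halfline_integral (\<lambda>u. Re (1 / (cx y u ^ (Suc k+1) * cx a (-u)))) (1 / (y+a) * (0 + pi / (y + a) ^ (k+1)))"
  proof (rule has_halfline_integral_cong)
    fix u :: real
    have "1 / (cx y u ^ (k+2) * cx a (-u))
      = (1 / cx y u ^ (k+2) + 1 / (cx y u ^ (k+1) * cx a (-u))) / (cx y u + cx a (-u))"
    proof -
      have "(Y * Y ^ k * A) \<noteq> 0 \<Longrightarrow> Y + A \<noteq> 0 \<Longrightarrow>
        1 / (Y ^ (k+2) * A) = (1 / Y ^ (k+2) + 1 / (Y ^ (k+1) * A)) / (Y + A)" for Y A :: complex
        by (simp add: divide_simps)
      moreover have "cx y u + cx a (-u) \<noteq> 0" using assms by (simp add: complex_eq_iff)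
      ultimately show ?thesis using assms cx_nonzero[of a "-u"] cx_nonzero[of y u] by (auto simp del: of_real_minus)
    qed
    also have "cx y u + cx a (-u) = of_real (y + a)" by simp
    finally show "1 / (y+a) * (Re (1 / cx y u ^ (k+2)) + Re (1 / (cx y u ^ (k+1) * cx a (-u))))
      = Re (1 / (cx y u ^ (Suc k+1) * cx a (-u)))"
      unfolding Re_divide_of_real by simp
  qed
  then show ?case by simp
qed

text \<open>The integrand is even in u, and as functions of u both factors vanish only in the upper
  half plane, so a contour closed below gives 0. The proof here is by partial fractions: the
  difference of the two factors is the constant \<open>a - y\<close>. The case a = y is a pure
  power.\<close>

lemma has_halfline_integral_cross:
  assumes "y > 0" "a > 0"
  shows "has_halfline_integral (\<lambda>u. Re (1 / (cx y u ^ (k+1) * cx a u))) 0"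
proof (cases "a = y")
  case True
  then show ?thesis using has_halfline_integral_Re_power[OF assms(1), of k] by (simp add: mult.commute)
next
  case False
  show ?thesis
  proof (induction k)
    case 0
    have "has_halfline_integral (\<lambda>u. 1 / (a - y) * (Re (1 / cx y u) - Re (1 / cx a u))) (1 / (a-y) * (pi/2 - pi/2))"
      by (intro has_halfline_integral_cmult has_halfline_integral_diff has_halfline_integral_Re_inverse assms)
    then have "has_halfline_integral (\<lambda>u. Re (1 / (cx y u * cx a u))) (1 / (a-y) * (pi/2 - pi/2))"
    proof (rule has_halfline_integral_cong)
      fix u :: real
      have "1 / (cx y u * cx a u) = (1 / cx y u - 1 / cx a u) / of_real (a - y)"
      proof -
        have "Y \<noteq> 0 \<Longrightarrow> A \<noteq> 0 \<Longrightarrow> D \<noteq> 0 \<Longrightarrow> D = A - Y \<Longrightarrow> 1 / (Y * A) = (1 / Y - 1 / A) / D" for Y A D :: complex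
          by (simp add: divide_simps)
        then show ?thesis using assms False by simp
      qed
      then show "1 / (a-y) * (Re (1 / cx y u) - Re (1 / cx a u)) = Re (1 / (cx y u * cx a u))"
        unfolding Re_divide_of_real minus_complex.sel by simp
    qed
    then show ?case by simp
  next
    case (Suc k)
    have "has_halfline_integral (\<lambda>u. 1 / (a-y) * (Re (1 / cx y u ^ (k+2)) - Re (1 / (cx y u ^ (k+1) * cx a u))))
        (1 / (a-y) * (0 - 0))"
      by (intro has_halfline_integral_cmult has_halfline_integral_diff has_halfline_integral_Re_power assms Suc)
    then have "has_halfline_integral (\<lambda>u. Re (1 / (cx y u ^ (Suc k+1) * cx a u))) (1 / (a-y) * (0 - 0))"
    proof (rule has_halfline_integral_cong)
      fix u :: real
      have "1 / (cx y u ^ (k+2) * cx a u)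
        = (1 / cx y u ^ (k+2) - 1 / (cx y u ^ (k+1) * cx a u)) / of_real (a - y)"
      proof -
        have "Y \<noteq> 0 \<Longrightarrow> A \<noteq> 0 \<Longrightarrow> D \<noteq> 0 \<Longrightarrow> D = A - Y \<Longrightarrow>
          1 / (Y ^ (k+2) * A) = (1 / Y ^ (k+2) - 1 / (Y ^ (k+1) * A)) / D" for Y A D :: complex
          by (simp add: divide_simps)
        then show ?thesis using assms False by simp
      qed
      then show "1 / (a-y) * (Re (1 / cx y u ^ (k+2)) - Re (1 / (cx y u ^ (k+1) * cx a u)))
        = Re (1 / (cx y u ^ (Suc k+1) * cx a u))"
        unfolding Re_divide_of_real by simp
    qed
    then show ?case by simp
  qed
qed

lemma ln_div_tendsto_0:
  fixes a :: real
  assumes "a > 0"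
  shows "((\<lambda>u. ln (1 + u^2 / a^2) / (1 + u)) \<longlongrightarrow> 0) at_top"
proof -
  obtain C where C: "C \<ge> 0" "\<And>u. u \<ge> 0 \<Longrightarrow> \<bar>ln (1 + u^2 / a^2)\<bar> \<le> C * (1 + u) powr (1/2)"
    using ln_quadratic_le[OF assms] by blast
  have "((\<lambda>u::real. C * (1 + u) powr (-(1/2))) \<longlongrightarrow> C * 0) at_top"
    by (intro tendsto_intros tendsto_neg_powr filterlim_tendsto_add_at_top[OF tendsto_const] filterlim_ident) auto
  then have lim: "((\<lambda>u. C * (1 + u) powr (-(1/2))) \<longlongrightarrow> 0) at_top" by simp
  show ?thesis
  proof (rule Lim_null_comparison[OF _ lim])
    show "\<forall>\<^sub>F u in at_top. norm (ln (1 + u^2 / a^2) / (1 + u)) \<le> C * (1 + u) powr (-(1/2))"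
      using eventually_ge_at_top[of 0]
    proof eventually_elim
      case (elim u)
      have "norm (ln (1 + u^2 / a^2) / (1 + u)) = \<bar>ln (1 + u^2 / a^2)\<bar> * (1 + u) powr (-1)"
        using elim by (simp add: powr_minus divide_inverse abs_mult)
      also have "\<dots> \<le> (C * (1 + u) powr (1/2)) * (1 + u) powr (-1)"
        by (intro mult_right_mono C elim) auto
      also have "\<dots> = C * (1 + u) powr (-(1/2))" unfolding mult.assoc powr_add[symmetric] by simp
      finally show ?case .
      qed
qed
qed

text \<open>Integration by parts: \<open>F\<close> is the primitive of the power times L, and the
  remaining integrand, with L', splits into the cross terms \<open>g\<close> and \<open>h\<close>.
  Only \<open>h\<close>, whose poles lie in both half planes, contributes. The boundary terms vanish
  because L is 0 at u = 0 and grows more slowly than the decay at infinity.\<close>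

lemma has_halfline_integral_Re_power_ln:
  assumes "y > 0" "a > 0"
  shows "has_halfline_integral (\<lambda>u. Re (1 / cx y u ^ (k + 2)) * ln (1 + u^2 / a^2))
           (- (pi / real (k + 1)) / (y + a) ^ (k + 1))"
proof -
  let ?L = "\<lambda>u::real. ln (1 + u^2 / a^2)"
  define F where "F = (\<lambda>u. Re (\<i> / of_nat (k+1) * (1 / cx y u ^ (k+1))) * ?L u)"
  define g where "g = (\<lambda>u. Re (1 / (cx y u ^ (k+1) * cx a u)))"
  define h where "h = (\<lambda>u. Re (1 / (cx y u ^ (k+1) * cx a (-u))))"
  let ?f = "\<lambda>u. Re (1 / cx y u ^ (k + 2)) * ?L u"
  have int: "set_integrable lborel {0..} ?f"
  proof (rule set_integrable_mult_ln[OF _ assms(2), of _ "((1 + y) / y)^2 * (1 / y)^k"])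
    fix u :: real assume u: "u \<ge> 0"
    have "\<bar>Re (1 / cx y u ^ (k + 2))\<bar> \<le> ((1 + y) / y)^2 * (1 / y)^k * (1 / (1 + u)^2)"
      using abs_Re_le_cmod[of "1 / cx y u ^ (k + 2)"] norm_inverse_cx_power_le[OF u assms(1), of k] by simp
    also have "\<dots> \<le> ((1 + y) / y)^2 * (1 / y)^k * (1 + u) powr (-(7/4))"
      by (intro mult_left_mono powr_bound_of_power2 u) (use assms in auto)
    finally show "\<bar>Re (1 / cx y u ^ (k + 2))\<bar> \<le> ((1 + y) / y)^2 * (1 / y)^k * (1 + u) powr (-7/4)"
      by simp
  qed measurable
  have cross: "has_halfline_integral (\<lambda>u. 1 / real (k+1) * (g u - h u)) (1 / real (k+1) * (0 - pi / (y + a) ^ (k + 1)))"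
    unfolding g_def h_def by (intro has_halfline_integral_cmult has_halfline_integral_diff has_halfline_integral_cross has_halfline_integral_cross_cnj assms)
  have "has_halfline_integral (\<lambda>u. ?f u - 1 / real (k+1) * (g u - h u)) (0 - F 0)"
  proof (rule has_halfline_integral_FTC)
    show "set_integrable lborel {0..} (\<lambda>u. ?f u - 1 / real (k+1) * (g u - h u))"
      using int cross by (auto simp: has_halfline_integral_def)
    fix u :: real assume "u \<ge> 0"
    have "((\<lambda>z. \<i> / of_nat (k+1) * (1 / z ^ (k+1))) has_field_derivative
        \<i> / of_nat (k+1) * (- of_nat (k+1) / cx y u ^ (k+1+1))) (at (cx y u))"
      by (intro DERIV_cmult has_field_derivative_inverse_power) (use assms in auto)
    from Re_cx_deriv[OF this]
    have d1: "((\<lambda>u. Re (\<i> / of_nat (k+1) * (1 / cx y u ^ (k+1)))) has_real_derivative Re (1 / cx y u ^ (k + 2))) (at u)"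
      by (simp add: field_simps del: of_nat_Suc)
    have pos: "1 + u^2 / a^2 > 0" by (simp add: add_pos_nonneg)
    have d2: "(?L has_real_derivative (2 * u / (a^2 + u^2))) (at u)"
      using assms pos by (auto intro!: derivative_eq_intros simp: field_simps add_nonneg_eq_0_iff power2_eq_square)
    \<comment> \<open>Partial fractions of L'. Since the value is real, it can be moved inside
      \<open>Re\<close> in the next step.\<close>
    have "\<i> * (1 / cx a u - 1 / cx a (-u)) = of_real (2 * u / (a^2 + u^2))"
    proof -
      have *: "cx a u * cx a (-u) = of_real (a^2 + u^2)" by (simp add: algebra_simps power2_eq_square)
      have "1 / cx a u - 1 / cx a (-u) = (cx a (-u) - cx a u) / (cx a u * cx a (-u))"
        using cx_nonzero[OF assms(2), of u] cx_nonzero[OF assms(2), of "-u"] by (simp only: diff_divide_distrib) (simp del: of_real_minus)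
      also have "\<dots> = (- 2 * \<i> * of_real u) / of_real (a^2 + u^2)" unfolding * by simp
      finally have "\<i> * (1 / cx a u - 1 / cx a (-u)) = (\<i> * (- 2 * \<i> * of_real u)) / of_real (a^2 + u^2)"
        by (simp only: times_divide_eq_right)
      also have "\<i> * (- 2 * \<i> * of_real u) = of_real (2 * u)" by (simp add: complex_eq_iff)
      finally show ?thesis by (simp only: of_real_divide)
    qed
    then have "Re (\<i> / of_nat (k+1) * (1 / cx y u ^ (k+1))) * (2 * u / (a^2 + u^2))
      = Re (\<i> / of_nat (k+1) * (1 / cx y u ^ (k+1)) * (\<i> * (1 / cx a u - 1 / cx a (-u))))"
      by (simp only: Re_complex_of_real Im_complex_of_real times_complex.sel(1) mult_zero_right diff_zero)
    also have "\<i> / of_nat (k+1) * (1 / cx y u ^ (k+1)) * (\<i> * (1 / cx a u - 1 / cx a (-u)))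
      = - ((1 / (cx y u ^ (k+1) * cx a u) - 1 / (cx y u ^ (k+1) * cx a (-u))) / of_real (real (k+1)))"
    proof -
      have "\<i> / K * (1 / Y) * (\<i> * (1 / P - 1 / Q)) = - ((1 / (Y * P) - 1 / (Y * Q)) / K)" for K Y P Q :: complex
        by (simp add: divide_inverse algebra_simps)
      then show ?thesis by simp
    qed
    also have "Re \<dots> = - (1 / real (k+1) * (g u - h u))"
      unfolding g_def h_def uminus_complex.sel Re_divide_of_real by simp
    finally have eq: "Re (\<i> / of_nat (k+1) * (1 / cx y u ^ (k+1))) * (2 * u / (a^2 + u^2)) = - (1 / real (k+1) * (g u - h u))" .
    have "(F has_real_derivative (?f u - 1 / real (k+1) * (g u - h u))) (at u)"
      unfolding F_def using DERIV_mult[OF d1 d2] eq by (simp only: mult.commute) (simp add: algebra_simps)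
    then show "(F has_real_derivative (?f u - 1 / real (k+1) * (g u - h u))) (at u within {0..})"
      by (rule has_field_derivative_at_within)
  next
    show "(F \<longlongrightarrow> 0) at_top"
    proof (rule Lim_null_comparison)
      let ?C = "((1 + y) / y) * (1 / y)^k"
      show "\<forall>\<^sub>F u in at_top. norm (F u) \<le> ?C * \<bar>?L u / (1 + u)\<bar>"
        using eventually_ge_at_top[of 0]
      proof eventually_elim
        case (elim u)
        have "norm (1 / cx y u) \<le> 1 / y"
          using norm_cx_ge(1)[OF elim assms(1)] assms by (simp add: norm_divide frac_le)
        then have "norm (1 / cx y u)^k * norm (1 / cx y u) \<le> (1 / y)^k * (((1 + y) / y) / (1 + u))"
          by (intro mult_mono power_mono norm_inverse_cx_le elim assms) (use assms in auto)
        then have n: "norm (1 / cx y u ^ (k+1)) \<le> ?C / (1 + u)"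
          by (simp add: norm_divide norm_mult norm_power power_divide mult_ac)
        have "\<bar>Re (\<i> / of_nat (k+1) * (1 / cx y u ^ (k+1)))\<bar> \<le> norm (\<i> / of_nat (k+1) * (1 / cx y u ^ (k+1)))"
          by (rule abs_Re_le_cmod)
        also have "\<dots> = 1 / real (k+1) * norm (1 / cx y u ^ (k+1))"
          by (simp only: norm_mult norm_divide norm_ii norm_of_nat)
        also have "\<dots> \<le> 1 * (?C / (1 + u))"
          by (intro mult_mono n) auto
        finally have "\<bar>F u\<bar> \<le> ?C / (1 + u) * \<bar>?L u\<bar>"
          unfolding F_def abs_mult by (intro mult_right_mono) auto
        then show ?case using elim by (simp add: abs_mult)
      qed
      have "((\<lambda>u. ?C * \<bar>?L u / (1 + u)\<bar>) \<longlongrightarrow> ?C * \<bar>0\<bar>) at_top"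
        by (intro tendsto_intros ln_div_tendsto_0 assms)
      then show "((\<lambda>u. ?C * \<bar>?L u / (1 + u)\<bar>) \<longlongrightarrow> 0) at_top" by simp
    qed
  qed
  moreover have "F 0 = 0" by (simp add: F_def)
  ultimately have "has_halfline_integral (\<lambda>u. ?f u - 1 / real (k+1) * (g u - h u)) 0" by simp
  from has_halfline_integral_add[OF this cross] show ?thesis by simp
qed

section \<open>The integral of Re (1/w) against the logarithm, by Tonelli\<close>

text \<open>Obtained by differentiating ln (1 + u^2/b^2) in b, which vanishes at b = infinity. The
  logarithm becomes an integral of nonnegative rational functions, so that orders of integration can
  be exchanged without further estimates.\<close>

lemma nn_integral_ln_kernel:
  fixes a u :: real
  assumes "a > 0"
  shows "(\<integral>\<^sup>+b. ennreal (2 * u^2 / (b * (b^2 + u^2))) * indicator {a..} b \<partial>lborel)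
    = ennreal (ln (1 + u^2 / a^2))"
proof -
  have "((\<lambda>b::real. - ln (1 + u^2 / b^2)) \<longlongrightarrow> - ln (1 + 0)) at_top"
    by (intro tendsto_intros tendsto_divide_0[OF tendsto_const] filterlim_at_top_imp_at_infinity
        filterlim_pow_at_top filterlim_ident) auto
  then have lim: "((\<lambda>b::real. - ln (1 + u^2 / b^2)) \<longlongrightarrow> 0) at_top" by simp
  have "(\<integral>\<^sup>+b. ennreal (2 * u^2 / (b * (b^2 + u^2))) * indicator {a..} b \<partial>lborel)
    = ennreal (0 - (- ln (1 + u^2 / a^2)))"
  proof (rule nn_integral_FTC_atLeast[OF _ _ _ lim])
    fix b :: real assume "a \<le> b"
    then have b: "b > 0" using assms by simp
    then have "1 + u^2 / b^2 > 0" by (simp add: add_pos_nonneg)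
    then have "((\<lambda>b. - ln (1 + u^2 / b^2)) has_real_derivative (2 * u^2 / b^3) / (1 + u^2 / b^2)) (at b)"
      using b by (auto intro!: derivative_eq_intros simp: power2_eq_square power3_eq_cube mult_ac)
    also have "1 + u^2 / b^2 = (b^2 + u^2) / b^2" using b by (simp add: field_simps)
    also have "(2 * u^2 / b^3) / ((b^2 + u^2) / b^2) = 2 * u^2 / (b * (b^2 + u^2))"
      using b by (simp add: power2_eq_square power3_eq_cube)
    finally show "((\<lambda>b. - ln (1 + u^2 / b^2)) has_real_derivative 2 * u^2 / (b * (b^2 + u^2))) (at b)" .
    show "0 \<le> 2 * u^2 / (b * (b^2 + u^2))" using b by simp
  qed measurable
  then show ?thesis by simp
qed

text \<open>Partial fractions in u^2 reduce the integrand to a difference of two arctangent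
  derivatives. They divide by b^2 - y^2, hence the condition \<open>b \<noteq> y\<close>.\<close>

lemma nn_integral_two_poles:
  fixes b y :: real
  assumes "b > 0" "y > 0" "b \<noteq> y"
  shows "(\<integral>\<^sup>+u. ennreal (y / (y^2 + u^2) * (2 * u^2 / (b * (b^2 + u^2)))) * indicator {0..} u \<partial>lborel)
    = ennreal (pi * y / (b * (b + y)))"
proof -
  let ?F = "\<lambda>u. 2 * y / (b * (b^2 - y^2)) * (b * arctan (u / b) - y * arctan (u / y))"
  have lim: "(?F \<longlongrightarrow> 2 * y / (b * (b^2 - y^2)) * (b * (pi/2) - y * (pi/2))) at_top"
    by (intro tendsto_intros tendsto_arctan_div assms)
  have "(\<integral>\<^sup>+u. ennreal (y / (y^2 + u^2) * (2 * u^2 / (b * (b^2 + u^2)))) * indicator {0..} u \<partial>lborel)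
    = ennreal (2 * y / (b * (b^2 - y^2)) * (b * (pi/2) - y * (pi/2)) - ?F 0)"
  proof (rule nn_integral_FTC_atLeast[OF _ _ _ lim])
    fix u :: real
    have pos: "b^2 + u^2 > 0" "y^2 + u^2 > 0" using assms by (simp_all add: add_pos_nonneg)
    have at: "((\<lambda>u. c * arctan (u / c)) has_real_derivative c^2 / (c^2 + u^2)) (at u)" if "c > 0" for c
      using that by (auto intro!: derivative_eq_intros simp: field_simps power2_eq_square add_nonneg_eq_0_iff)
    have nz: "b^2 - y^2 \<noteq> 0" using assms by (simp add: power2_eq_iff)
    have "2 * y / (b * (b^2 - y^2)) * (b^2 / (b^2 + u^2) - y^2 / (y^2 + u^2))
      = y / (y^2 + u^2) * (2 * u^2 / (b * (b^2 + u^2)))"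
    proof -
      have "b^2 / (b^2 + u^2) - y^2 / (y^2 + u^2) = (b^2 - y^2) * (u^2 / ((b^2 + u^2) * (y^2 + u^2)))"
      proof -
        have "b^2 / (b^2 + u^2) - y^2 / (y^2 + u^2)
          = (b^2 * (y^2 + u^2) - y^2 * (b^2 + u^2)) / ((b^2 + u^2) * (y^2 + u^2))"
          using pos by (intro diff_frac_eq) auto
        also have "b^2 * (y^2 + u^2) - y^2 * (b^2 + u^2) = (b^2 - y^2) * u^2" by (simp add: algebra_simps)
        finally show ?thesis by simp
      qed
      then show ?thesis using nz assms by (simp add: mult_ac)
    qed
    moreover have "(?F has_real_derivative 2 * y / (b * (b^2 - y^2)) * (b^2 / (b^2 + u^2) - y^2 / (y^2 + u^2))) (at u)"
      by (intro DERIV_cmult DERIV_diff at assms)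
    ultimately show "(?F has_real_derivative y / (y^2 + u^2) * (2 * u^2 / (b * (b^2 + u^2)))) (at u)" by simp
    show "0 \<le> y / (y^2 + u^2) * (2 * u^2 / (b * (b^2 + u^2)))" using assms by simp
  qed measurable
  also have "2 * y / (b * (b^2 - y^2)) * (b * (pi/2) - y * (pi/2)) - ?F 0 = pi * y / (b * (b + y))"
  proof -
    have "b^2 - y^2 = (b - y) * (b + y)" by (simp add: power2_eq_square algebra_simps)
    moreover have "b * (pi/2) - y * (pi/2) = (b - y) * (pi / 2)" by (simp add: algebra_simps)
    ultimately show ?thesis using assms by (simp add: divide_simps) (simp add: algebra_simps)
  qed
  finally show ?thesis .
qed

lemma nn_integral_pole_tail:
  fixes a y :: real
  assumes "a > 0" "y > 0"
  shows "(\<integral>\<^sup>+b. ennreal (pi * y / (b * (b + y))) * indicator {a..} b \<partial>lborel)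
    = ennreal (pi * ln (1 + y / a))"
proof -
  have "((\<lambda>b::real. - (pi * ln (1 + y / b))) \<longlongrightarrow> - (pi * ln (1 + 0))) at_top"
    by (intro tendsto_intros tendsto_divide_0[OF tendsto_const] filterlim_at_top_imp_at_infinity
        filterlim_ident) auto
  then have lim: "((\<lambda>b::real. - (pi * ln (1 + y / b))) \<longlongrightarrow> 0) at_top" by simp
  have "(\<integral>\<^sup>+b. ennreal (pi * y / (b * (b + y))) * indicator {a..} b \<partial>lborel)
    = ennreal (0 - (- (pi * ln (1 + y / a))))"
  proof (rule nn_integral_FTC_atLeast[OF _ _ _ lim])
    fix b :: real assume "a \<le> b"
    then have b: "b > 0" using assms by simp
    then have "1 + y / b > 0" using assms by (simp add: add_pos_nonneg)
    then have "((\<lambda>b. - (pi * ln (1 + y / b))) has_real_derivative (pi * y / b^2) / (1 + y / b)) (at b)"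
      using b by (auto intro!: derivative_eq_intros simp: power2_eq_square mult_ac)
    also have "1 + y / b = (b + y) / b" using b by (simp add: field_simps)
    also have "(pi * y / b^2) / ((b + y) / b) = pi * y / (b * (b + y))"
      using b by (simp add: power2_eq_square)
    finally show "((\<lambda>b. - (pi * ln (1 + y / b))) has_real_derivative pi * y / (b * (b + y))) (at b)" .
    show "0 \<le> pi * y / (b * (b + y))" using b assms by simp
  qed measurable
  then show ?thesis by simp
qed

text \<open>For the first power the primitive is an arctangent, and integration by parts would not
  leave a rational integrand. Instead L is expanded by \<open>nn_integral_ln_kernel\<close>; after
  the exchange the u-integral is elementary, and so is the b-integral that follows.\<close>

lemma has_halfline_integral_Re_inverse_ln:
  assumes "y > 0" "a > 0"
  shows "has_halfline_integral (\<lambda>u. Re (1 / cx y u) * ln (1 + u^2 / a^2)) (pi * ln (1 + y / a))"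
proof -
  let ?f = "\<lambda>u. Re (1 / cx y u) * ln (1 + u^2 / a^2)"
  let ?K = "\<lambda>u b. ennreal (y / (y^2 + u^2) * (2 * u^2 / (b * (b^2 + u^2)))) * indicator {a..} b * indicator {0..} u"
  have int: "set_integrable lborel {0..} ?f"
  proof (rule set_integrable_mult_ln[OF _ assms(2), of _ "y * ((1 + y) / y)^2"])
    fix u :: real assume u: "u \<ge> 0"
    have "\<bar>Re (1 / cx y u)\<bar> \<le> y * ((1 + y) / y)^2 * (1 / (1 + u)^2)"
      using abs_Re_inverse_cx_le[OF u assms(1)] by simp
    also have "\<dots> \<le> y * ((1 + y) / y)^2 * (1 + u) powr (-(7/4))"
      by (intro mult_left_mono powr_bound_of_power2 u) (use assms in auto)
    finally show "\<bar>Re (1 / cx y u)\<bar> \<le> y * ((1 + y) / y)^2 * (1 + u) powr (-7/4)" by simp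
  qed measurable
  have "(\<integral>\<^sup>+u. ennreal (indicat_real {0..} u *\<^sub>R ?f u) \<partial>lborel) = (\<integral>\<^sup>+u. \<integral>\<^sup>+b. ?K u b \<partial>lborel \<partial>lborel)"
  proof (rule nn_integral_cong)
    fix u :: real
    have "(\<integral>\<^sup>+b. ?K u b \<partial>lborel) = (\<integral>\<^sup>+b. (ennreal (y / (y^2 + u^2)) * indicator {0..} u) *
        (ennreal (2 * u^2 / (b * (b^2 + u^2))) * indicator {a..} b) \<partial>lborel)"
      by (intro nn_integral_cong) (use assms in \<open>auto simp: indicator_def simp flip: ennreal_mult'\<close>)
    also have "\<dots> = (ennreal (y / (y^2 + u^2)) * indicator {0..} u) * ennreal (ln (1 + u^2 / a^2))"
      by (subst nn_integral_cmult) (use nn_integral_ln_kernel[OF assms(2)] in auto)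
    also have "\<dots> = ennreal (indicat_real {0..} u *\<^sub>R ?f u)"
      unfolding Re_inverse_cx using assms by (auto simp: indicator_def simp flip: ennreal_mult')
    finally show "ennreal (indicat_real {0..} u *\<^sub>R ?f u) = (\<integral>\<^sup>+b. ?K u b \<partial>lborel)" ..
  qed
  also have "\<dots> = (\<integral>\<^sup>+b. \<integral>\<^sup>+u. ?K u b \<partial>lborel \<partial>lborel)"
    by (rule lborel_pair.Fubini'[symmetric]) measurable
  also have "\<dots> = (\<integral>\<^sup>+b. ennreal (pi * y / (b * (b + y))) * indicator {a..} b \<partial>lborel)"
  proof (rule nn_integral_cong_AE)
    \<comment> \<open>The value b = y, where the partial fractions break down, is a null
      set.\<close>
    show "AE b in lborel. (\<integral>\<^sup>+u. ?K u b \<partial>lborel) = ennreal (pi * y / (b * (b + y))) * indicator {a..} b"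
      using AE_lborel_singleton[of y]
    proof eventually_elim
      case (elim b)
      show ?case
      proof (cases "b \<ge> a")
        case True
        then show ?thesis using nn_integral_two_poles[of b y] elim assms by simp
      qed simp
    qed
  qed
  also have "\<dots> = ennreal (pi * ln (1 + y / a))" by (rule nn_integral_pole_tail[OF assms(2,1)])
  finally have "(\<integral>\<^sup>+u. ennreal (indicat_real {0..} u *\<^sub>R ?f u) \<partial>lborel) = ennreal (pi * ln (1 + y / a))" .
  then have "(LBINT u:{0..}. ?f u) = pi * ln (1 + y / a)"
    unfolding set_lebesgue_integral_def Re_inverse_cx
    by (subst integral_eq_nn_integral) (use assms in auto)
  with int show ?thesis by (simp add: has_halfline_integral_def)
qed

section \<open>Interchanging the series and the integral\<close>

text \<open>Mean value inequality on the horizontal ray \<open>S\<close> to the right of X = r + w.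
  Since Re X > 0, the modulus is smallest at X, where the derivative bound is therefore taken.
  \<open>S\<close> is written with two opposite inequalities for \<open>Im\<close> so that it is an
  intersection of convex half planes.\<close>

lemma norm_inverse_power_diff_le:
  fixes w :: complex and r t :: real
  assumes "Re w > 0" "0 \<le> r" "r \<le> t" "t \<le> r + 1"
  shows "norm (1 / (of_real r + w) ^ m - 1 / (of_real t + w) ^ m) \<le> real m / norm (of_real r + w) ^ (m + 1)"
proof -
  define X where "X = of_real r + w"
  define S where "S = {z. Im z \<le> Im w} \<inter> {z. Im z \<ge> Im w} \<inter> {z. Re z \<ge> Re X}"
  have X: "Re X > 0" "norm X > 0" using assms by (auto simp: X_def complex_eq_iff)
  have "norm (1 / X ^ m - 1 / (of_real t + w) ^ m) \<le> real m / norm X ^ (m+1) * norm (X - (of_real t + w))"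
  proof (rule field_differentiable_bound[where S = S])
    show "convex S"
      unfolding S_def by (intro convex_Int convex_halfspace_Re_ge convex_halfspace_Im_ge convex_halfspace_Im_le)
    fix z assume z: "z \<in> S"
    then have "z \<noteq> 0" using X by (auto simp: S_def)
    then show "((\<lambda>z. 1 / z ^ m) has_field_derivative - of_nat m / z ^ (m + 1)) (at z within S)"
      by (rule has_field_derivative_inverse_power)
    have "Im z = Im X" "Re X \<le> Re z" using z by (auto simp: S_def X_def)
    then have "norm X \<le> norm z" using X by (simp add: cmod_def power_mono)
    then show "norm (- of_nat m / z ^ (m + 1)) \<le> real m / norm X ^ (m + 1)"
      unfolding norm_divide norm_power norm_minus_cancel norm_of_nat
      using X by (intro divide_left_mono power_mono mult_pos_pos zero_less_power) auto
  qed (use assms in \<open>auto simp: S_def X_def\<close>)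
  also have "\<dots> \<le> real m / norm X ^ (m+1) * 1"
  proof (intro mult_left_mono)
    have "X - (of_real t + w) = of_real (r - t)" by (simp add: X_def)
    then show "norm (X - (of_real t + w)) \<le> 1" using assms by (simp only: norm_of_real)
  qed auto
  finally show ?thesis by (simp add: X_def)
qed

text \<open>The split 3 = 5/4 + 7/4 gives t just enough decay and leaves u a reserve of 1/2 for the
  logarithm; the factor is 8 = 2^3.\<close>

lemma inverse_cube_le:
  fixes r t u :: real
  assumes "t \<ge> 0" "u \<ge> 0" "r \<ge> (1 + t) / 2" "r \<ge> (1 + u) / 2"
  shows "1 / r ^ 3 \<le> 8 * ((1 + t) powr (-5/4) * (1 + u) powr (-7/4))"
proof -
  have r: "r > 0" using assms by simp
  have "1 / r ^ 3 = r powr (-5/4) * r powr (-7/4)"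
  proof -
    have "r powr (-5/4) * r powr (-7/4) = r powr (-3)" by (simp flip: powr_add)
    also have "\<dots> = 1 / r ^ 3" using r by (simp add: powr_minus powr_numeral divide_inverse)
    finally show ?thesis by simp
  qed
  also have "\<dots> \<le> ((1 + t) / 2) powr (-5/4) * ((1 + u) / 2) powr (-7/4)"
    using assms by (intro mult_mono powr_mono2') auto
  also have "\<dots> = ((1/2) powr (-5/4) * (1/2) powr (-7/4)) * ((1 + t) powr (-5/4) * (1 + u) powr (-7/4))"
  proof -
    have "((1 + t) / 2) powr (-5/4) = (1 + t) powr (-5/4) * (1/2) powr (-5/4)"
      using assms powr_mult[of "1 + t" "1/2" "-5/4"] by (simp only: times_divide_eq_right mult_1_right)
    moreover have "((1 + u) / 2) powr (-7/4) = (1 + u) powr (-7/4) * (1/2) powr (-7/4)"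
      using assms powr_mult[of "1 + u" "1/2" "-7/4"] by (simp only: times_divide_eq_right mult_1_right)
    ultimately show ?thesis by (simp only: mult_ac)
  qed
  also have "(1/2::real) powr (-5/4) * (1/2) powr (-7/4) = 8"
  proof -
    have "(1/2::real) powr (-5/4) * (1/2) powr (-7/4) = (1/2) powr (-3)" by (simp flip: powr_add)
    also have "\<dots> = 8" by (simp add: powr_minus powr_numeral power_divide)
    finally show ?thesis .
  qed
  finally show ?thesis .
qed

text \<open>Indicators extend the integrand to the plane, where a product of integrable functions
  dominates it. Integrability of \<open>V\<close> and \<open>W\<close> is then a consequence and
  needs no bounds of its own.\<close>

lemma half_line_Fubini:
  fixes f :: "real \<Rightarrow> real \<Rightarrow> real"
  assumes meas: "(\<lambda>(t,u). f t u) \<in> borel_measurable (borel \<Otimes>\<^sub>M borel)"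
    and p: "p > 1" and C: "C \<ge> 0"
    and bound: "\<And>t u. t \<ge> 0 \<Longrightarrow> u \<ge> 0 \<Longrightarrow> \<bar>f t u\<bar> \<le> C * ((1 + t) powr (-p) * (1 + u) powr (-p))"
    and V: "\<And>t. t \<ge> 0 \<Longrightarrow> has_halfline_integral (f t) (V t)"
    and W: "\<And>u. u \<ge> 0 \<Longrightarrow> has_halfline_integral (\<lambda>t. f t u) (W u)"
  shows "\<exists>v. has_halfline_integral V v \<and> has_halfline_integral W v"
proof -
  define g where "g = (\<lambda>t::real. indicat_real {0..} t *\<^sub>R (1 + t) powr (-p))"
  define \<psi> where "\<psi> = (\<lambda>t u. indicat_real {0..} t * indicat_real {0..} u * f t u)"
  have g: "integrable lborel g"
    using set_integrable_powr[OF p] by (simp add: g_def set_integrable_def)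
  have g_meas[measurable]: "g \<in> borel_measurable borel" by (simp add: g_def)
  have g0: "g t \<ge> 0" for t by (simp add: g_def)
  have prod: "integrable (lborel \<Otimes>\<^sub>M lborel) (\<lambda>(t,u). C * (g t * g u))"
  proof (rule lborel_pair.Fubini_integrable)
    show "(\<lambda>(t,u). C * (g t * g u)) \<in> borel_measurable (lborel \<Otimes>\<^sub>M lborel)" by measurable
    have "(\<integral>u. norm (case (t, u) of (t, u) \<Rightarrow> C * (g t * g u)) \<partial>lborel) = C * (g t * (\<integral>u. g u \<partial>lborel))" for t
      using g0 C by (simp add: abs_mult)
    then show "integrable lborel (\<lambda>t. \<integral>u. norm (case (t, u) of (t, u) \<Rightarrow> C * (g t * g u)) \<partial>lborel)"
      using g by simp
    show "AE t in lborel. integrable lborel (\<lambda>u. case (t, u) of (t, u) \<Rightarrow> C * (g t * g u))"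
      using g by simp
  qed
  have int: "integrable (lborel \<Otimes>\<^sub>M lborel) (\<lambda>(t,u). \<psi> t u)"
  proof (rule Bochner_Integration.integrable_bound[OF prod])
    have [measurable]: "(\<lambda>(t,u). f t u) \<in> borel_measurable (lborel \<Otimes>\<^sub>M lborel)"
      using meas by (simp cong: measurable_cong_sets)
    show "(\<lambda>(t,u). \<psi> t u) \<in> borel_measurable (lborel \<Otimes>\<^sub>M lborel)"
      unfolding \<psi>_def by measurable
    have "norm (\<psi> t u) \<le> norm (C * (g t * g u))" for t u
      using bound[of t u] C by (auto simp: \<psi>_def g_def indicator_def)
    then show "AE x in lborel \<Otimes>\<^sub>M lborel. norm (case x of (t, u) \<Rightarrow> \<psi> t u) \<le> norm (case x of (t, u) \<Rightarrow> C * (g t * g u))"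
      by (intro AE_I2) auto
  qed
  have 1: "(\<integral>u. \<psi> t u \<partial>lborel) = indicat_real {0..} t *\<^sub>R V t" for t
  proof (cases "t \<ge> 0")
    case True
    then show ?thesis using V[OF True]
      by (simp add: \<psi>_def has_halfline_integral_def set_lebesgue_integral_def)
  qed (simp add: \<psi>_def)
  have 2: "(\<integral>t. \<psi> t u \<partial>lborel) = indicat_real {0..} u *\<^sub>R W u" for u
  proof (cases "u \<ge> 0")
    case True
    then show ?thesis using W[OF True]
      by (simp add: \<psi>_def has_halfline_integral_def set_lebesgue_integral_def)
  qed (simp add: \<psi>_def)
  have "integrable lborel (\<lambda>t. \<integral>u. \<psi> t u \<partial>lborel)" "integrable lborel (\<lambda>u. \<integral>t. \<psi> t u \<partial>lborel)"
    using lborel_pair.integrable_fst[OF int] lborel_pair.integrable_snd[OF int] by simp_all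
  moreover have "(\<integral>u. \<integral>t. \<psi> t u \<partial>lborel \<partial>lborel) = (\<integral>t. \<integral>u. \<psi> t u \<partial>lborel \<partial>lborel)"
    using lborel_pair.Fubini_integral[OF int] .
  ultimately show ?thesis
    unfolding 1 2 has_halfline_integral_def set_integrable_def set_lebesgue_integral_def by auto
qed

section \<open>Partial sums as integrals of step functions, and the t-integral for fixed u\<close>

lemma has_integral_step_minus:
  fixes g :: "nat \<Rightarrow> real" and h H :: "real \<Rightarrow> real"
  assumes "\<And>t. t \<ge> 0 \<Longrightarrow> (H has_real_derivative h t) (at t within {0..})"
  shows "((\<lambda>t. g (nat \<lfloor>t\<rfloor>) - h t) has_integral ((\<Sum>n<N. g n) - (H (real N) - H 0))) {0..real N}"
proof (induction N)
  case 0
  then show ?case by (simp add: has_integral_refl)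
next
  case (Suc N)
  have "((\<lambda>t. g N - h t) has_integral (g N - (H (real (Suc N)) - H (real N)))) {real N..real (Suc N)}"
  proof (rule has_integral_diff)
    show "((\<lambda>_. g N) has_integral g N) {real N..real (Suc N)}"
      using has_integral_const_real[of "g N" "real N" "real (Suc N)"] by simp
    show "(h has_integral (H (real (Suc N)) - H (real N))) {real N..real (Suc N)}"
      by (rule fundamental_theorem_of_calculus)
        (auto simp flip: has_real_derivative_iff_has_vector_derivative intro!: DERIV_subset[OF assms])
  qed
  then have "((\<lambda>t. g (nat \<lfloor>t\<rfloor>) - h t) has_integral (g N - (H (real (Suc N)) - H (real N)))) {real N..real (Suc N)}"
  \<comment> \<open>At the right end point the floor already jumps to \<open>Suc N\<close>; this
    single point is removed.\<close>
  proof (rule has_integral_spike_finite[of "{real (Suc N)}", rotated 2])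
    fix t assume "t \<in> {real N..real (Suc N)} - {real (Suc N)}"
    then have "\<lfloor>t\<rfloor> = int N" by (auto simp: floor_eq_iff)
    then show "g (nat \<lfloor>t\<rfloor>) - h t = g N - h t" by simp
  qed auto
  from has_integral_combine[OF _ _ Suc.IH this] show ?case by (simp add: algebra_simps)
qed

lemma has_halfline_integral_step_tendsto:
  assumes "has_halfline_integral (\<lambda>t. g (nat \<lfloor>t\<rfloor>) - h t) v"
    and "\<And>t. t \<ge> 0 \<Longrightarrow> (H has_real_derivative h t) (at t within {0..})"
  shows "(\<lambda>N. (\<Sum>n<N. g n) - (H (real N) - H 0)) \<longlonglongrightarrow> v"
proof -
  have "((\<lambda>b. integral {0..b} (\<lambda>t. g (nat \<lfloor>t\<rfloor>) - h t)) \<longlongrightarrow> v) at_top"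
    using assms(1) tendsto_integral_half_line by (auto simp: has_halfline_integral_def)
  then have "(\<lambda>N. integral {0..real N} (\<lambda>t. g (nat \<lfloor>t\<rfloor>) - h t)) \<longlonglongrightarrow> v"
    by (rule filterlim_compose[OF _ filterlim_real_sequentially])
  then show ?thesis
    by (simp add: integral_unique[OF has_integral_step_minus[OF assms(2)]])
qed

lemma cx_add: "of_real t + cx c u = cx (t + c) u"
  by simp

text \<open>The cancellation behind the whole argument: the difference decays like the third power
  of the modulus, although each of the two terms only decays like the second.\<close>

lemma kernel_difference_bound:
  fixes p :: "nat \<Rightarrow> real"
  assumes c: "c \<ge> 1" and K: "K \<ge> 1" and u: "u \<ge> 0" and t: "real n \<le> t" "t \<le> real n + 1"
    and A: "A \<ge> 0" "\<bar>p n - t ^ K\<bar> \<le> A * (real n + 1) ^ (K - 1)"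
  shows "\<bar>p n * Re (1 / cx (real n + c) u ^ (K + 2)) - t ^ K * Re (1 / cx (t + c) u ^ (K + 2))\<bar>
    \<le> 8 * (A + real K + 2) * ((1 + t) powr (-5/4) * (1 + u) powr (-7/4))"
proof -
  define X where "X = cx (real n + c) u"
  define Z where "Z = cx (t + c) u"
  define r where "r = norm X"
  have rn: "r \<ge> real n + c" "r \<ge> u"
    using norm_cx_ge[of u "real n + c"] u c by (auto simp: r_def X_def)
  \<comment> \<open>Here c >= 1 matters: it makes \<open>r\<close> dominate t as well as n +
    1.\<close>
  then have rn1: "r \<ge> real n + 1" and r0: "r > 0" using c by linarith+
  have "\<bar>p n * Re (1 / X ^ (K + 2)) - t ^ K * Re (1 / Z ^ (K + 2))\<bar>
    = \<bar>Re (of_real (p n - t^K) * (1 / X ^ (K + 2)) + of_real (t ^ K) * (1 / X ^ (K + 2) - 1 / Z ^ (K + 2)))\<bar>"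
    unfolding plus_complex.sel Re_complex_of_real Im_complex_of_real times_complex.sel minus_complex.sel
    by (simp add: algebra_simps)
  also have "\<dots> \<le> norm (of_real (p n - t^K) * (1 / X ^ (K + 2)) + of_real (t ^ K) * (1 / X ^ (K + 2) - 1 / Z ^ (K + 2)))"
    by (rule abs_Re_le_cmod)
  also have "\<dots> \<le> \<bar>p n - t^K\<bar> * (1 / r ^ (K + 2)) + \<bar>t ^ K\<bar> * norm (1 / X ^ (K + 2) - 1 / Z ^ (K + 2))"
    by (rule order_trans[OF norm_triangle_ineq])
      (simp add: norm_mult norm_divide norm_power r_def del: of_real_diff of_real_power power_Suc add_2_eq_Suc')
  \<comment> \<open>Both summands are of order r^(-3): the first because P(n) and t^K share their
    leading term, the second because the difference of inverse powers gains one order.\<close>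
  also have "\<dots> \<le> (A * r ^ (K - 1)) * (1 / r ^ (K + 2)) + r ^ K * (real (K + 2) / r ^ (K + 2 + 1))"
  proof (intro add_mono mult_mono)
    show "\<bar>p n - t^K\<bar> \<le> A * r ^ (K - 1)"
      using rn1 by (intro order_trans[OF A(2)] mult_left_mono power_mono A(1)) auto
    show "\<bar>t ^ K\<bar> \<le> r ^ K"
      using t rn1 by (simp add: power_mono)
    show "norm (1 / X ^ (K + 2) - 1 / Z ^ (K + 2)) \<le> real (K + 2) / r ^ (K + 2 + 1)"
      using norm_inverse_power_diff_le[of "cx c u" "real n" t "K + 2"] t c
      by (simp only: cx_add X_def Z_def r_def) simp
  qed (use r0 A in auto)
  also have "\<dots> = (A + real K + 2) * (1 / r ^ 3)"
  proof -
    have "K + 2 = (K - 1) + 3" "K + 2 + 1 = K + 3" using K by simp_all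
    then have "r ^ (K + 2) = r ^ (K - 1) * r ^ 3" "r ^ (K + 2 + 1) = r ^ K * r ^ 3"
      by (simp_all only: power_add)
    then have "(A * r ^ (K - 1)) * (1 / r ^ (K + 2)) = A * (1 / r ^ 3)"
      "r ^ K * (real (K + 2) / r ^ (K + 2 + 1)) = (real K + 2) * (1 / r ^ 3)"
      using r0 by simp (simp only: \<open>r ^ (K + 2 + 1) = r ^ K * r ^ 3\<close>, use r0 in simp)
    then show ?thesis by (simp only: distrib_right)
  qed
  also have "\<dots> \<le> (A + real K + 2) * (8 * ((1 + t) powr (-5/4) * (1 + u) powr (-7/4)))"
    by (intro mult_left_mono inverse_cube_le) (use u t A rn rn1 in auto)
  finally show ?thesis by (simp only: X_def Z_def mult_ac)
qed

lemma floor_bounds: "t \<ge> 0 \<Longrightarrow> real (nat \<lfloor>t\<rfloor>) \<le> t \<and> t \<le> real (nat \<lfloor>t\<rfloor>) + 1"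
  by (simp add: of_nat_nat)

lemma tendsto_of_nat_div_add:
  fixes w :: "'a :: {real_normed_field}"
  shows "(\<lambda>N. of_nat N / (of_nat N + w)) \<longlonglongrightarrow> 1"
proof -
  have lim: "filterlim (\<lambda>N. of_nat N + w) at_infinity sequentially"
    by (rule tendsto_add_filterlim_at_infinity'[OF tendsto_of_nat tendsto_const])
  then have "(\<lambda>N. 1 - w / (of_nat N + w)) \<longlonglongrightarrow> 1 - 0"
    by (intro tendsto_intros tendsto_divide_0[OF tendsto_const])
  moreover have "\<forall>\<^sub>F N in sequentially. 1 - w / (of_nat N + w) = of_nat N / (of_nat N + w)"
    using filterlim_at_infinity_imp_eventually_ne[OF lim, of 0]
    by eventually_elim (simp add: field_simps)
  ultimately show ?thesis by (simp add: Lim_transform_eventually)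
qed

lemma ln_add_minus_ln_tendsto:
  fixes x :: real
  assumes "x \<ge> 0"
  shows "(\<lambda>N. ln (real N + x) - ln (real N)) \<longlonglongrightarrow> 0"
proof (rule Lim_transform_eventually)
  have "(\<lambda>N. - ln (real N / (real N + x))) \<longlonglongrightarrow> - ln 1"
    by (intro tendsto_intros tendsto_of_nat_div_add) auto
  then show "(\<lambda>N. - ln (real N / (real N + x))) \<longlonglongrightarrow> 0" by simp
  show "\<forall>\<^sub>F N in sequentially. - ln (real N / (real N + x)) = ln (real N + x) - ln (real N)"
    using eventually_gt_at_top[of 0] by eventually_elim (use assms in \<open>simp add: ln_div\<close>)
qed

lemma Re_of_real_mult: "Re (of_real x * z) = x * Re z"
  by simp

text \<open>Convergence of the series of \<open>g\<close> is not assumed. Integrability of the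
  difference gives a limit of partial sums minus \<open>H\<close>, and \<open>H\<close> itself
  converges.\<close>

lemma has_halfline_integral_kernel:
  fixes p :: "nat \<Rightarrow> real"
  assumes c: "c \<ge> 1" and K: "K \<ge> 1" and u: "u \<ge> 0" and A: "A \<ge> 0"
    and p: "\<And>n t. real n \<le> t \<Longrightarrow> t \<le> real n + 1 \<Longrightarrow> \<bar>p n - t ^ K\<bar> \<le> A * (real n + 1) ^ (K - 1)"
  defines "g \<equiv> (\<lambda>n. p n * Re (1 / cx (real n + c) u ^ (K + 2)))"
  shows "has_halfline_integral (\<lambda>t. g (nat \<lfloor>t\<rfloor>) - t ^ K * Re (1 / cx (t + c) u ^ (K + 2)))
     (suminf g - 1 / real (K + 1) * Re (1 / cx c u))"
proof -
  define w where "w = cx c u"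
  have w: "w \<noteq> 0" "Re w > 0" using c by (auto simp: w_def complex_eq_iff)
  let ?f = "\<lambda>t. g (nat \<lfloor>t\<rfloor>) - t ^ K * Re (1 / cx (t + c) u ^ (K + 2))"
  have "set_integrable lborel {0..} ?f"
  proof (rule set_integrable_powr_bound[of _ "5/4" "8 * (A + real K + 2) * (1 + u) powr (-7/4)"])
    show "?f \<in> borel_measurable borel" unfolding g_def by measurable
    fix t :: real assume t: "t \<ge> 0"
    show "\<bar>?f t\<bar> \<le> 8 * (A + real K + 2) * (1 + u) powr (-7/4) * (1 + t) powr (-(5/4))"
      using kernel_difference_bound[OF c K u _ _ A p, where n = "nat \<lfloor>t\<rfloor>" and t = t] floor_bounds[OF t]
      by (simp only: g_def mult_ac minus_divide_left)
  qed simp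
  then obtain v where v: "has_halfline_integral ?f v" by (auto simp: has_halfline_integral_def)
  \<comment> \<open>The derivative of t/(t+w) is w/(t+w)^2, so this is a primitive of t^K times the
    real part of (t+w)^(-K-2). As t/(t+w) tends to 1, the limit 1/((K+1) w) appears.\<close>
  define H where "H = (\<lambda>t. Re ((of_real t / (of_real t + w)) ^ (K + 1) / (of_nat (K + 1) * w)))"
  have lim: "(\<lambda>N. (\<Sum>n<N. g n) - (H (real N) - H 0)) \<longlonglongrightarrow> v"
  proof (rule has_halfline_integral_step_tendsto[OF v])
    fix t :: real assume t: "t \<ge> 0"
    have nz: "of_real t + w \<noteq> 0" using t w by (auto simp: complex_eq_iff)
    have "((\<lambda>z. (z / (z + w)) ^ (K + 1) / (of_nat (K + 1) * w)) has_field_derivative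
        (of_nat (K + 1) * (of_real t / (of_real t + w)) ^ K * (w / (of_real t + w)^2)) / (of_nat (K + 1) * w)) (at (of_real t))"
    proof -
      have "((\<lambda>z. z / (z + w)) has_field_derivative w / (of_real t + w)^2) (at (of_real t))"
        using nz by (auto intro!: derivative_eq_intros simp: field_simps power2_eq_square)
      from DERIV_power[OF this, of "K + 1"] show ?thesis
        by (intro DERIV_cdivide) (simp add: mult_ac)
    qed
    also have "(of_nat (K + 1) * (of_real t / (of_real t + w)) ^ K * (w / (of_real t + w)^2)) / (of_nat (K + 1) * w)
      = of_real (t ^ K) * (1 / (of_real t + w) ^ (K + 2))"
    proof -
      have "k \<noteq> 0 \<Longrightarrow> (k * (T / Z) ^ K * (w / Z^2)) / (k * w) = T ^ K * (1 / Z ^ (K + 2))" for k T Z :: complex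
        using w by (simp add: power_divide power_add power2_eq_square)
      from this[of "of_nat (K+1)" "of_real t" "of_real t + w"] show ?thesis by (simp del: of_nat_Suc)
    qed
    finally have "((\<lambda>t. (of_real t / (of_real t + w)) ^ (K + 1) / (of_nat (K + 1) * w)) has_vector_derivative
       of_real (t ^ K) * (1 / (of_real t + w) ^ (K + 2))) (at t within {0..})"
      by (rule has_vector_derivative_real_field)
    then have "(H has_real_derivative Re (of_real (t ^ K) * (1 / (of_real t + w) ^ (K + 2)))) (at t within {0..})"
      unfolding H_def by (rule has_field_derivative_Re)
    then show "(H has_real_derivative t ^ K * Re (1 / cx (t + c) u ^ (K + 2))) (at t within {0..})"
      unfolding Re_of_real_mult w_def cx_add .
  qed
  have "(\<lambda>N. Re ((of_nat N / (of_nat N + w)) ^ (K + 1) / (of_nat (K + 1) * w))) \<longlonglongrightarrow> Re (1 ^ (K + 1) / (of_nat (K + 1) * w))"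
    by (intro tendsto_intros tendsto_of_nat_div_add) (use w in \<open>auto simp del: of_nat_Suc\<close>)
  moreover have "1 ^ (K + 1) / (of_nat (K + 1) * w) = of_real (1 / real (K + 1)) * (1 / w)" by simp
  ultimately have "(\<lambda>N. H (real N)) \<longlonglongrightarrow> Re (of_real (1 / real (K + 1)) * (1 / w))"
    unfolding H_def by simp
  then have limH: "(\<lambda>N. H (real N) - H 0) \<longlonglongrightarrow> 1 / real (K + 1) * Re (1 / w)"
    unfolding Re_of_real_mult by (simp add: H_def)
  from tendsto_add[OF lim limH] have "g sums (v + 1 / real (K + 1) * Re (1 / w))"
    by (simp add: sums_def)
  then show "has_halfline_integral ?f (suminf g - 1 / real (K + 1) * Re (1 / cx c u))"
    using v by (simp add: sums_iff w_def)
qed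

text \<open>Successive integrands differ by t^K x/(t+x)^(K+2), which is the derivative of
  (t/(t+x))^(K+1)/(K+1); hence the induction. The correction sum tends to \<open>harm K\<close> at
  infinity.\<close>

lemma DERIV_ln_minus_powers:
  fixes x t :: real
  assumes "x > 0" "t \<ge> 0"
  shows "((\<lambda>t. ln (t + x) - (\<Sum>j=1..K. (t / (t + x)) ^ j / real j)) has_real_derivative t ^ K / (t + x) ^ (K + 1)) (at t)"
proof (induction K)
  case 0
  then show ?case using assms by (auto intro!: derivative_eq_intros)
next
  case (Suc K)
  have "((\<lambda>t. t / (t + x)) has_real_derivative x / (t + x)^2) (at t)"
    using assms by (auto intro!: derivative_eq_intros simp: field_simps power2_eq_square)
  from DERIV_cdivide[OF DERIV_power[OF this, of "Suc K"], of "real (Suc K)"]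
  have "((\<lambda>t. (t / (t + x)) ^ Suc K / real (Suc K)) has_real_derivative (t / (t + x)) ^ K * (x / (t + x)^2)) (at t)"
    by (simp add: mult_ac del: of_nat_Suc)
  from DERIV_diff[OF Suc.IH this]
  have "((\<lambda>t. ln (t + x) - (\<Sum>j=1..Suc K. (t / (t + x)) ^ j / real j)) has_real_derivative
      t ^ K / (t + x) ^ (K + 1) - (t / (t + x)) ^ K * (x / (t + x)^2)) (at t)"
    by (simp add: algebra_simps)
  also have "t ^ K / (t + x) ^ (K + 1) - (t / (t + x)) ^ K * (x / (t + x)^2) = t ^ Suc K / (t + x) ^ (Suc K + 1)"
  proof -
    have "s > 0 \<Longrightarrow> t ^ K / s ^ (K + 1) - (t / s) ^ K * ((s - t) / s^2) = t ^ Suc K / s ^ (Suc K + 1)" for s :: real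
      by (simp add: power_divide power2_eq_square divide_simps) (simp add: algebra_simps)
    from this[of "t + x"] show ?thesis using assms by simp
  qed
  finally show ?case .
qed

section \<open>The series integrated against the logarithm\<close>

text \<open>The common value \<open>v\<close> of the two iterated integrals is computed from
  \<open>V\<close>, where the u-integration is explicit and the limit \<open>M\<close> enters. Read
  through \<open>W\<close>, the same \<open>v\<close> is the wanted integral minus the explicit one
  of Re (1/w) L.\<close>

theorem has_halfline_integral_series_mult_ln:
  fixes p :: "nat \<Rightarrow> real"
  assumes c: "c \<ge> 1" and K: "K \<ge> 1" and a: "a > 0" and A: "A \<ge> 0"
    and p: "\<And>n t. real n \<le> t \<Longrightarrow> t \<le> real n + 1 \<Longrightarrow> \<bar>p n - t ^ K\<bar> \<le> A * (real n + 1) ^ (K - 1)"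
    and M: "(\<lambda>N. (\<Sum>n<N. p n / (real n + c + a) ^ (K + 1)) - ln (real N)) \<longlonglongrightarrow> M"
  shows "has_halfline_integral (\<lambda>u. (\<Sum>n. p n * Re (1 / cx (real n + c) u ^ (K + 2))) * ln (1 + u^2 / a^2))
     (- (pi / real (K + 1)) * (ln a + harm K + M))"
proof -
  define x where "x = c + a"
  have x: "x > 0" using c a by (simp add: x_def)
  let ?L = "\<lambda>u::real. ln (1 + u^2 / a^2)"
  define f where "f = (\<lambda>t u. (p (nat \<lfloor>t\<rfloor>) * Re (1 / cx (real (nat \<lfloor>t\<rfloor>) + c) u ^ (K + 2))
     - t ^ K * Re (1 / cx (t + c) u ^ (K + 2))) * ?L u)"
  define V where "V = (\<lambda>t. - (pi / real (K + 1)) * (p (nat \<lfloor>t\<rfloor>) / (real (nat \<lfloor>t\<rfloor>) + x) ^ (K + 1)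
     - t ^ K / (t + x) ^ (K + 1)))"
  define S where "S = (\<lambda>u. \<Sum>n. p n * Re (1 / cx (real n + c) u ^ (K + 2)))"
  define W where "W = (\<lambda>u. (S u - 1 / real (K + 1) * Re (1 / cx c u)) * ?L u)"
  obtain D where D: "D \<ge> 0" "\<And>u. u \<ge> 0 \<Longrightarrow> \<bar>?L u\<bar> \<le> D * (1 + u) powr (1/2)"
    using ln_quadratic_le[OF a] by blast
  have "\<exists>v. has_halfline_integral V v \<and> has_halfline_integral W v"
  proof (rule half_line_Fubini)
    show "(\<lambda>(t,u). f t u) \<in> borel_measurable (borel \<Otimes>\<^sub>M borel)"
      unfolding f_def by measurable
    show "(5/4::real) > 1" "8 * (A + real K + 2) * D \<ge> 0" using A D by auto
  next
    fix t u :: real assume t: "t \<ge> 0" and u: "u \<ge> 0"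
    have "\<bar>f t u\<bar> \<le> (8 * (A + real K + 2) * ((1 + t) powr (-5/4) * (1 + u) powr (-7/4))) * (D * (1 + u) powr (1/2))"
      unfolding f_def abs_mult
      by (intro mult_mono D u kernel_difference_bound c K A p) (use A floor_bounds[OF t] in auto)
    also have "\<dots> = 8 * (A + real K + 2) * D * ((1 + t) powr (-5/4) * ((1 + u) powr (-7/4) * (1 + u) powr (1/2)))"
      by (simp only: mult_ac)
    also have "(1 + u) powr (-7/4) * (1 + u) powr (1/2) = (1 + u) powr (-(5/4))" by (simp flip: powr_add)
    finally show "\<bar>f t u\<bar> \<le> 8 * (A + real K + 2) * D * ((1 + t) powr (-(5/4)) * (1 + u) powr (-(5/4)))"
      by simp
  next
    fix t :: real assume t: "t \<ge> 0"
    have "has_halfline_integral (\<lambda>u. p (nat \<lfloor>t\<rfloor>) * (Re (1 / cx (real (nat \<lfloor>t\<rfloor>) + c) u ^ (K + 2)) * ?L u)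
        - t ^ K * (Re (1 / cx (t + c) u ^ (K + 2)) * ?L u))
      (p (nat \<lfloor>t\<rfloor>) * (- (pi / real (K + 1)) / (real (nat \<lfloor>t\<rfloor>) + c + a) ^ (K + 1))
        - t ^ K * (- (pi / real (K + 1)) / (t + c + a) ^ (K + 1)))"
      by (intro has_halfline_integral_diff has_halfline_integral_cmult has_halfline_integral_Re_power_ln) (use c t a in \<open>auto simp: add_nonneg_pos\<close>)
    moreover have "p (nat \<lfloor>t\<rfloor>) * (- (pi / real (K + 1)) / (real (nat \<lfloor>t\<rfloor>) + c + a) ^ (K + 1))
        - t ^ K * (- (pi / real (K + 1)) / (t + c + a) ^ (K + 1)) = V t"
      unfolding V_def x_def add.assoc by (simp only: right_diff_distrib times_divide_eq_right mult.commute)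
    ultimately show "has_halfline_integral (f t) (V t)"
      unfolding f_def by (simp only: left_diff_distrib mult.assoc)
  next
    fix u :: real assume u: "u \<ge> 0"
    show "has_halfline_integral (\<lambda>t. f t u) (W u)"
      using has_halfline_integral_cmult[OF has_halfline_integral_kernel[OF c K u A p], of "?L u"]
      unfolding f_def W_def S_def by (simp only: mult.commute)
  qed
  then obtain v where v: "has_halfline_integral V v" "has_halfline_integral W v" by blast
  define H where "H = (\<lambda>t. ln (t + x) - (\<Sum>j=1..K. (t / (t + x)) ^ j / real j))"
  have "has_halfline_integral (\<lambda>t. - (real (K + 1) / pi) * V t) (- (real (K + 1) / pi) * v)"
    by (intro has_halfline_integral_cmult v)
  then have "has_halfline_integral (\<lambda>t. p (nat \<lfloor>t\<rfloor>) / (real (nat \<lfloor>t\<rfloor>) + x) ^ (K + 1) - t ^ K / (t + x) ^ (K + 1)) (- (real (K + 1) / pi) * v)"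
  proof (rule has_halfline_integral_cong)
    fix t
    have "- (k / pi) * (- (pi / k) * z) = z" if "k \<noteq> 0" for k z :: real using that by simp
    then show "- (real (K + 1) / pi) * V t = p (nat \<lfloor>t\<rfloor>) / (real (nat \<lfloor>t\<rfloor>) + x) ^ (K + 1) - t ^ K / (t + x) ^ (K + 1)"
      unfolding V_def by (simp del: of_nat_Suc)
  qed
  then have lim1: "(\<lambda>N. (\<Sum>n<N. p n / (real n + x) ^ (K + 1)) - (H (real N) - H 0)) \<longlonglongrightarrow> - (real (K + 1) / pi) * v"
    by (rule has_halfline_integral_step_tendsto)
      (auto simp: H_def intro!: has_field_derivative_at_within DERIV_ln_minus_powers[OF x, simplified])
  have lim2: "(\<lambda>N. H (real N) - ln (real N)) \<longlonglongrightarrow> 0 - harm K"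
  proof -
    have "(\<lambda>N. (\<Sum>j=1..K. (real N / (real N + x)) ^ j / real j)) \<longlonglongrightarrow> (\<Sum>j=1..K. 1 ^ j / real j)"
      by (intro tendsto_intros tendsto_of_nat_div_add) auto
    moreover have "(\<Sum>j=1..K. 1 ^ j / real j) = harm K"
      by (simp add: harm_def divide_inverse)
    moreover have "(\<lambda>N. ln (real N + x) - ln (real N)) \<longlonglongrightarrow> 0"
      using x by (intro ln_add_minus_ln_tendsto) simp
    ultimately have "(\<lambda>N. (ln (real N + x) - ln (real N)) - (\<Sum>j=1..K. (real N / (real N + x)) ^ j / real j)) \<longlonglongrightarrow> 0 - harm K"
      by (intro tendsto_diff) simp_all
    then show ?thesis by (simp add: H_def algebra_simps)
  qed
  have "H 0 = ln x"
  proof -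
    have "(\<Sum>j=1..K. (0 / (0 + x)) ^ j / real j) = 0" by (intro sum.neutral) auto
    then show ?thesis by (simp add: H_def)
  qed
  \<comment> \<open>Adding the two limits cancels \<open>H (real N)\<close> and leaves ln N, so that
    uniqueness of limits ties \<open>v\<close> to \<open>M\<close>.\<close>
  have "(\<lambda>N. ((\<Sum>n<N. p n / (real n + x) ^ (K + 1)) - (H (real N) - H 0)) + (H (real N) - ln (real N)) - H 0)
     \<longlonglongrightarrow> - (real (K + 1) / pi) * v + (0 - harm K) - H 0"
    by (intro tendsto_intros lim1 lim2)
  then have "(\<lambda>N. (\<Sum>n<N. p n / (real n + c + a) ^ (K + 1)) - ln (real N)) \<longlonglongrightarrow> - (real (K + 1) / pi) * v - harm K - ln x"
    by (simp add: \<open>H 0 = ln x\<close> x_def add.assoc)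
  from tendsto_unique[OF _ this M] have eq_M: "- (real (K + 1) / pi) * v - harm K - ln x = M" by simp
  have v_eq: "v = - (pi / real (K + 1)) * (ln x + harm K + M)"
  proof -
    from eq_M have "ln x + harm K + M = - (real (K + 1) / pi) * v" by linarith
    then have "- (pi / real (K + 1)) * (ln x + harm K + M) = - (pi / real (K + 1)) * (- (real (K + 1) / pi) * v)"
      by (simp only:)
    also have "\<dots> = v"
    proof -
      have "- (pi / k) * (- (k / pi) * z) = z" if "k \<noteq> 0" for k z :: real using that by simp
      then show ?thesis by (simp del: of_nat_Suc)
    qed
    finally show ?thesis ..
  qed
  \<comment> \<open>The subtracted term is put back; its ln (1 + c/a) = ln x - ln a removes the ln x
    contained in \<open>v\<close>.\<close>
  have "has_halfline_integral (\<lambda>u. W u + 1 / real (K + 1) * (Re (1 / cx c u) * ?L u)) (v + 1 / real (K + 1) * (pi * ln (1 + c / a)))"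
    by (intro has_halfline_integral_add v has_halfline_integral_cmult has_halfline_integral_Re_inverse_ln) (use c a in auto)
  then have "has_halfline_integral (\<lambda>u. S u * ?L u) (v + 1 / real (K + 1) * (pi * ln (1 + c / a)))"
    by (rule has_halfline_integral_cong) (simp add: W_def algebra_simps)
  moreover have "v + 1 / real (K + 1) * (pi * ln (1 + c / a)) = - (pi / real (K + 1)) * (ln a + harm K + M)"
  proof -
    have "1 + c / a = x / a" using a by (simp add: x_def field_simps)
    then have *: "ln (1 + c / a) = ln x - ln a" using x a by (simp add: ln_div)
    show ?thesis unfolding v_eq * by (simp add: divide_inverse algebra_simps)
  qed
  ultimately show ?thesis unfolding S_def by simp
qed

section \<open>The derivative of the digamma term\<close>

text \<open>Leibniz rule in which \<open>f i\<close> and \<open>g i\<close> stand for the i-th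
  derivatives. The set is open because \<open>deriv\<close> at a point needs the induction
  hypothesis in a neighbourhood.\<close>

lemma higher_deriv_mult_sequences:
  fixes f g :: "nat \<Rightarrow> real \<Rightarrow> real"
  assumes "open S"
    and f: "\<And>i t. t \<in> S \<Longrightarrow> (f i has_real_derivative f (Suc i) t) (at t)"
    and g: "\<And>i t. t \<in> S \<Longrightarrow> (g i has_real_derivative g (Suc i) t) (at t)"
    and "t \<in> S"
  shows "(deriv ^^ n) (\<lambda>t. f 0 t * g 0 t) t = (\<Sum>i\<le>n. real (n choose i) * (f (n - i) t * g i t))"
  using \<open>t \<in> S\<close>
proof (induction n arbitrary: t)
  case 0
  then show ?case by simp
next
  case (Suc n)
  let ?s = "\<lambda>t. \<Sum>i\<le>n. real (n choose i) * (f (n - i) t * g i t)"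
  have "\<forall>\<^sub>F s in nhds t. (deriv ^^ n) (\<lambda>t. f 0 t * g 0 t) s = ?s s"
    using eventually_nhds_in_open[OF \<open>open S\<close> Suc.prems] by eventually_elim (rule Suc.IH)
  then have "(deriv ^^ Suc n) (\<lambda>t. f 0 t * g 0 t) t = deriv ?s t"
    by (simp add: deriv_cong_ev)
  also have "\<dots> = (\<Sum>i\<le>n. real (n choose i) * (f (Suc n - i) t * g i t + f (n - i) t * g (Suc i) t))"
  proof (rule DERIV_imp_deriv, rule DERIV_sum)
    fix i assume "i \<in> {..n}"
    then have "Suc (n - i) = Suc n - i" by auto
    with DERIV_mult[OF f[OF Suc.prems, of "n - i"] g[OF Suc.prems, of i]]
    have "((\<lambda>t. f (n - i) t * g i t) has_real_derivative f (Suc n - i) t * g i t + f (n - i) t * g (Suc i) t) (at t)"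
      by (simp add: algebra_simps)
    then show "((\<lambda>t. real (n choose i) * (f (n - i) t * g i t)) has_real_derivative
        real (n choose i) * (f (Suc n - i) t * g i t + f (n - i) t * g (Suc i) t)) (at t)"
      by (rule DERIV_cmult)
  qed
  also have "\<dots> = (\<Sum>i\<le>n. real (n choose i) * (f (Suc n - i) t * g i t))
      + (\<Sum>i\<le>n. real (n choose i) * (f (n - i) t * g (Suc i) t))"
    by (simp add: distrib_left sum.distrib)
  \<comment> \<open>The extra term i = \<open>Suc n\<close> is 0 because its binomial coefficient
    vanishes; it prepares the index shift for Pascal's rule.\<close>
  also have "(\<Sum>i\<le>n. real (n choose i) * (f (Suc n - i) t * g i t))
      = (\<Sum>i\<le>Suc n. real (n choose i) * (f (Suc n - i) t * g i t))"
    by simp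
  also have "\<dots> = f (Suc n) t * g 0 t + (\<Sum>i\<le>n. real (n choose Suc i) * (f (n - i) t * g (Suc i) t))"
    by (subst sum.atMost_Suc_shift) simp
  finally show ?case
    by (subst sum.atMost_Suc_shift) (simp add: sum.distrib algebra_simps)
qed

lemma higher_pderiv_degree:
  fixes q :: "real poly"
  assumes "degree q \<le> K"
  shows "(pderiv ^^ K) q = [:fact K * coeff q K:]" "m > K \<Longrightarrow> (pderiv ^^ m) q = 0"
proof -
  show "(pderiv ^^ K) q = [:fact K * coeff q K:]"
  proof (rule poly_eqI)
    fix n show "coeff ((pderiv ^^ K) q) n = coeff [:fact K * coeff q K:] n"
      using assms by (cases n) (auto simp: coeff_higher_pderiv coeff_eq_0 pochhammer_fact)
  qed
  show "(pderiv ^^ m) q = 0" if "m > K"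
    by (rule poly_eqI) (use assms that in \<open>auto simp: coeff_higher_pderiv coeff_eq_0\<close>)
qed

text \<open>Maclaurin's formula with remainder of order K + 1; the remainder vanishes because that
  derivative of the polynomial is 0.\<close>

lemma poly_Taylor:
  fixes q :: "real poly"
  assumes "degree q \<le> K"
  shows "poly q (x + h) = (\<Sum>m\<le>K. poly ((pderiv ^^ m) q) x / fact m * h ^ m)"
proof -
  have "\<exists>t. \<bar>t\<bar> \<le> \<bar>h\<bar> \<and> poly q (x + h) = (\<Sum>m<Suc K. (poly ((pderiv ^^ m) q) (x + 0) / fact m) * h ^ m)
      + (poly ((pderiv ^^ Suc K) q) (x + t) / fact (Suc K)) * h ^ Suc K"
    by (rule Maclaurin_all_le[where diff = "\<lambda>m h. poly ((pderiv ^^ m) q) (x + h)" and f = "\<lambda>h. poly q (x + h)"])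
      (auto intro!: derivative_eq_intros)
  then show ?thesis
    using higher_pderiv_degree(2)[OF assms, of "Suc K"]
    by (auto simp del: funpow.simps simp: lessThan_Suc_atMost)
qed

text \<open>The leading coefficient is recorded because it makes the K-th derivative equal to 1, the
  later coefficient of ln N.\<close>

lemma gbinomial_as_poly:
  "\<exists>Q :: real poly. degree Q \<le> K \<and> coeff Q K = 1 / fact K \<and> (\<forall>t. poly Q t = (t - 1) gchoose K)"
proof -
  define R :: "real poly" where "R = (\<Prod>i\<in>{0..<K}. [:- (1 + real i), 1:])"
  have deg: "degree R = K" by (simp add: R_def degree_prod_eq_sum_degree)
  have "lead_coeff R = 1" by (simp add: R_def lead_coeff_prod)
  then have "coeff (smult (1 / fact K) R) K = 1 / fact K" by (simp add: deg)
  moreover have "poly (smult (1 / fact K) R) t = (t - 1) gchoose K" for t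
    by (simp add: R_def poly_prod gbinomial_prod_rev algebra_simps)
  ultimately show ?thesis using deg by (intro exI[of _ "smult (1 / fact K) R"]) simp
qed

text \<open>One formula for all orders, with the logarithm present only at i = 0, so that limits can
  be taken inside the Leibniz sum.\<close>

lemma Polygamma_tendsto:
  fixes z :: real
  assumes "z > 0"
  shows "(\<lambda>N. (if i = 0 then ln (real N) else 0) - (\<Sum>n<N. (-1) ^ i * fact i / (z + real n) ^ (i + 1)))
    \<longlonglongrightarrow> Polygamma i z"
proof (cases "i = 0")
  case True
  then show ?thesis using Digamma_LIMSEQ[of z] assms by (simp add: divide_inverse)
next
  case False
  have "(\<lambda>n. inverse ((z + of_nat n) ^ Suc i)) sums ((-1) ^ Suc i * Polygamma i z / fact i)"
    by (rule Polygamma_LIMSEQ) (use assms False in auto)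
  then have "(\<lambda>N. - ((-1) ^ i * fact i * (\<Sum>n<N. inverse ((z + of_nat n) ^ Suc i))))
      \<longlonglongrightarrow> - ((-1) ^ i * fact i * ((-1) ^ Suc i * Polygamma i z / fact i))"
    unfolding sums_def by (intro tendsto_intros)
  moreover have "- ((-1) ^ i * fact i * ((-1) ^ Suc i * Polygamma i z / fact i)) = Polygamma i z"
  proof -
    have "(-1 :: real) ^ i * (-1) ^ i = 1" by (simp flip: power_mult_distrib)
    then show ?thesis by simp
  qed
  moreover have "(\<lambda>N. (if i = 0 then ln (real N) else 0) - (\<Sum>n<N. (-1) ^ i * fact i / (z + real n) ^ (i + 1)))
    = (\<lambda>N. - ((-1) ^ i * fact i * (\<Sum>n<N. inverse ((z + of_nat n) ^ Suc i))))"
    using False by (simp add: sum_distrib_left divide_inverse)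
  ultimately show ?thesis by (simp only:)
qed

text \<open>The series of Digamma has simple poles at t0 = l - n. Dividing the polynomial Q by t -
  t0 leaves a quotient of degree below K, killed by K derivatives, so each pole contributes only
  Q(t0) times the K-th derivative of 1/(t - t0). These values of Q are the P(n - l) up to sign and
  K!.\<close>

lemma higher_deriv_gbinomial_Digamma:
  fixes x :: real
  assumes "l \<le> K" "x > real l"
  shows "(\<lambda>N. ln (real N) - (\<Sum>n<N. pochhammer (real n + 1) K / (real n + x) ^ (K + 1)))
     \<longlonglongrightarrow> (deriv ^^ K) (\<lambda>t. ((t - 1) gchoose K) * Digamma (t - real l)) x"
proof -
  obtain Q :: "real poly" where Q: "degree Q \<le> K" "coeff Q K = 1 / fact K" "\<And>t. poly Q t = (t - 1) gchoose K"
    using gbinomial_as_poly[of K] by auto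
  define f where "f = (\<lambda>i. poly ((pderiv ^^ i) Q))"
  define z where "z = x - real l"
  have z: "z > 0" using assms by (simp add: z_def)
  have fK: "f K x = 1" using higher_pderiv_degree(1)[OF Q(1)] Q(2) by (simp add: f_def)
  have "(deriv ^^ K) (\<lambda>t. f 0 t * Polygamma 0 (t - real l)) x
    = (\<Sum>i\<le>K. real (K choose i) * (f (K - i) x * Polygamma i (x - real l)))"
  proof (rule higher_deriv_mult_sequences[where S = "{real l<..}"])
    show "(f i has_real_derivative f (Suc i) t) (at t)" for i t
      by (auto simp: f_def intro!: derivative_eq_intros)
    show "((\<lambda>t. Polygamma i (t - real l)) has_real_derivative Polygamma (Suc i) (t - real l)) (at t)"
      if "t \<in> {real l<..}" for i t
    proof -
      have "t - real l \<notin> \<int>\<^sub>\<le>\<^sub>0" using that by (auto elim!: nonpos_Ints_cases)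
      then show ?thesis by (auto intro!: derivative_eq_intros)
    qed
  qed (use assms in auto)
  then have D: "(deriv ^^ K) (\<lambda>t. ((t - 1) gchoose K) * Digamma (t - real l)) x
    = (\<Sum>i\<le>K. real (K choose i) * (f (K - i) x * Polygamma i z))"
    by (simp add: f_def Q(3) z_def)
  define X where "X = (\<lambda>N. \<Sum>i\<le>K. real (K choose i) * (f (K - i) x *
      ((if i = 0 then ln (real N) else 0) - (\<Sum>n<N. (-1) ^ i * fact i / (z + real n) ^ (i + 1)))))"
  have X: "X \<longlonglongrightarrow> (\<Sum>i\<le>K. real (K choose i) * (f (K - i) x * Polygamma i z))"
    unfolding X_def by (intro tendsto_intros Polygamma_tendsto z)
  \<comment> \<open>Here s is the distance from x to the pole. After reversing the index, the
    Leibniz sum is the Taylor expansion of \<open>Q\<close> about x, evaluated at x - s.\<close>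
  have termwise: "(\<Sum>i\<le>K. real (K choose i) * (f (K - i) x * ((-1) ^ i * fact i / s ^ (i + 1))))
      = pochhammer (1 - (x - s)) K / s ^ (K + 1)" if "s > 0" for s
  proof -
    have "(\<Sum>i\<le>K. real (K choose i) * (f (K - i) x * ((-1) ^ i * fact i / s ^ (i + 1))))
      = (\<Sum>m\<le>K. real (K choose (K - m)) * (f m x * ((-1) ^ (K - m) * fact (K - m) / s ^ (K - m + 1))))"
      by (rule sum.reindex_bij_witness[of _ "\<lambda>m. K - m" "\<lambda>m. K - m"]) auto
    also have "\<dots> = (\<Sum>m\<le>K. (-1) ^ K * fact K / s ^ (K + 1) * (f m x / fact m * (- s) ^ m))"
    proof (rule sum.cong[OF refl])
      fix m assume "m \<in> {..K}"
      then have m: "m \<le> K" by simp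
      have 1: "real (K choose (K - m)) * fact (K - m) = fact K / fact m"
        using m binomial_fact[of "K - m" K, where ?'a = real] by (simp add: field_simps)
      have 2: "1 / s ^ (K - m + 1) = s ^ m / s ^ (K + 1)"
        using m that by (simp add: field_simps flip: power_add)
      have 3: "(-1 :: real) ^ (K - m) = (-1) ^ K * (-1) ^ m"
        using m by (simp add: minus_one_power_iff)
      have 4: "(- s) ^ m = (-1) ^ m * s ^ m" by (metis power_minus)
      have "real (K choose (K - m)) * (f m x * ((-1) ^ (K - m) * fact (K - m) / s ^ (K - m + 1)))
        = (real (K choose (K - m)) * fact (K - m)) * f m x * (-1) ^ (K - m) * (1 / s ^ (K - m + 1))"
        by simp
      also have "\<dots> = (-1) ^ K * fact K / s ^ (K + 1) * (f m x / fact m * (- s) ^ m)"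
        unfolding 1 2 3 4 by (simp add: mult_ac)
      finally show "real (K choose (K - m)) * (f m x * ((-1) ^ (K - m) * fact (K - m) / s ^ (K - m + 1)))
        = (-1) ^ K * fact K / s ^ (K + 1) * (f m x / fact m * (- s) ^ m)" .
    qed
    also have "\<dots> = (-1) ^ K * fact K / s ^ (K + 1) * poly Q (x + (- s))"
      unfolding poly_Taylor[OF Q(1)] f_def by (simp only: sum_distrib_left)
    also have "poly Q (x + (- s)) = (-1) ^ K * pochhammer (1 - (x - s)) K / fact K"
      by (simp add: Q(3) gbinomial_pochhammer algebra_simps)
    also have "(-1) ^ K * fact K / s ^ (K + 1) * ((-1) ^ K * pochhammer (1 - (x - s)) K / fact K)
      = ((-1) ^ K * (-1) ^ K) * (pochhammer (1 - (x - s)) K / s ^ (K + 1))"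
      by simp
    also have "(-1 :: real) ^ K * (-1) ^ K = 1" by (simp flip: power_mult_distrib)
    finally show ?thesis by simp
  qed
  have X_eq: "X N = ln (real N) - (\<Sum>n<N. pochhammer (1 - (real l - real n)) K / (z + real n) ^ (K + 1))" for N
  proof -
    have "X N = (\<Sum>i\<le>K. real (K choose i) * (f (K - i) x * (if i = 0 then ln (real N) else 0)))
      - (\<Sum>i\<le>K. \<Sum>n<N. real (K choose i) * (f (K - i) x * ((-1) ^ i * fact i / (z + real n) ^ (i + 1))))"
      unfolding X_def by (simp only: right_diff_distrib sum_subtractf sum_distrib_left)
    also have "(\<Sum>i\<le>K. real (K choose i) * (f (K - i) x * (if i = 0 then ln (real N) else 0)))
      = (\<Sum>i\<in>{0}. real (K choose i) * (f (K - i) x * ln (real N)))"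
      by (rule sum.mono_neutral_cong_right) auto
    also have "\<dots> = ln (real N)" by (simp add: fK)
    also have "(\<Sum>i\<le>K. \<Sum>n<N. real (K choose i) * (f (K - i) x * ((-1) ^ i * fact i / (z + real n) ^ (i + 1))))
      = (\<Sum>n<N. \<Sum>i\<le>K. real (K choose i) * (f (K - i) x * ((-1) ^ i * fact i / (z + real n) ^ (i + 1))))"
      by (rule sum.swap)
    also have "\<dots> = (\<Sum>n<N. pochhammer (1 - (real l - real n)) K / (z + real n) ^ (K + 1))"
      by (intro sum.cong refl, subst termwise) (use z in \<open>auto simp: z_def algebra_simps\<close>)
    finally show ?thesis .
  qed
  have X_shift: "X (N + l) = ln (real (N + l)) - (\<Sum>n<N. pochhammer (real n + 1) K / (real n + x) ^ (K + 1))" for N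
  proof -
    let ?t = "\<lambda>n. pochhammer (1 - (real l - real n)) K / (z + real n) ^ (K + 1)"
    have "sum ?t {..<N + l} = sum ?t {..<l} + (\<Sum>n<N. ?t (n + l))"
      by (induction N) simp_all
    \<comment> \<open>For n < l the Pochhammer symbol starts at the nonpositive integer -(l - n -
      1), and \<open>l \<le> K\<close> makes it long enough to reach the factor 0.\<close>
    also have "sum ?t {..<l} = 0"
    proof (rule sum.neutral, rule ballI)
      fix n assume "n \<in> {..<l}"
      then have n: "n < l" by simp
      then have "1 - (real l - real n) = - real (l - n - 1)" by (simp add: of_nat_diff)
      moreover have "l - n - 1 < K" using n assms by simp
      ultimately have "pochhammer (1 - (real l - real n)) K = 0"
        by (simp only: pochhammer_of_nat_eq_0_iff)
      then show "?t n = 0" by simp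
    qed
    also have "(\<Sum>n<N. ?t (n + l)) = (\<Sum>n<N. pochhammer (real n + 1) K / (real n + x) ^ (K + 1))"
      by (intro sum.cong refl) (simp add: z_def algebra_simps)
    finally show ?thesis unfolding X_eq by simp
  qed
  \<comment> \<open>Dropping the l vanishing terms shifts N, which the logarithm does not notice in
    the limit.\<close>
  have "(\<lambda>N. ln (real (N + l)) - ln (real N)) \<longlonglongrightarrow> 0"
    using ln_add_minus_ln_tendsto[of "real l"] by simp
  then have "(\<lambda>N. X (N + l) - (ln (real (N + l)) - ln (real N))) \<longlonglongrightarrow> (\<Sum>i\<le>K. real (K choose i) * (f (K - i) x * Polygamma i z)) - 0"
    by (intro tendsto_diff LIMSEQ_ignore_initial_segment X)
  then show ?thesis unfolding D X_shift by simp
qed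

section \<open>Hurwitz zeta and Stirling numbers\<close>

lemma norm_inverse_cube_le:
  assumes "c \<ge> 1" "u \<ge> 0"
  shows "1 / norm (of_nat n + cx c u) ^ 3 \<le> 8 * ((1 + real n) powr (-5/4) * (1 + u) powr (-7/4))"
proof -
  define r where "r = norm (of_nat n + cx c u)"
  have "of_nat n + cx c u = cx (real n + c) u" by simp
  then have r: "r \<ge> real n + c" "r \<ge> u"
    using norm_cx_ge[of u "real n + c"] assms by (simp_all only: r_def)
  have n: "real n \<ge> 0" by simp
  have "(1 + real n) / 2 \<le> r" using r n assms by simp
  moreover have "(1 + u) / 2 \<le> r" using r n assms by simp
  ultimately show ?thesis
    unfolding r_def[symmetric] using assms by (intro inverse_cube_le) auto
qed

lemma summable_powr_shift: "summable (\<lambda>n. (1 + real n) powr (-5/4))"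
proof -
  have "summable (\<lambda>n. real (Suc n) powr (-5/4))"
    by (subst summable_Suc_iff) (simp add: summable_real_powr_iff)
  then show ?thesis by (simp add: add.commute)
qed

lemma summable_norm_inverse_power:
  assumes "Re w > 0" "s \<ge> 2"
  shows "summable (\<lambda>n. norm (1 / (of_nat n + w) ^ s))"
proof (rule summable_comparison_test_ev)
  show "summable (\<lambda>n. inverse (real n ^ s))"
    using inverse_power_summable[of s, where ?'a = real] assms by simp
  show "\<forall>\<^sub>F n in sequentially. norm (norm (1 / (of_nat n + w) ^ s)) \<le> inverse (real n ^ s)"
    using eventually_gt_at_top[of 0]
  proof eventually_elim
    case (elim n)
    have "real n \<le> norm (of_nat n + w)"
      using complex_Re_le_cmod[of "of_nat n + w"] assms by simp
    then have "real n ^ s \<le> norm (of_nat n + w) ^ s" by (intro power_mono) auto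
    then have "inverse (norm (of_nat n + w) ^ s) \<le> inverse (real n ^ s)"
      using elim by (intro le_imp_inverse_le) auto
    then show ?case by (simp add: norm_divide norm_power divide_inverse norm_inverse)
  qed
qed

lemma hurwitz_zeta_sums:
  assumes "Re w > 0" "s \<ge> 2"
  shows "(\<lambda>n. 1 / (of_nat n + w) ^ s) sums hurwitz_zeta (of_nat s) w"
proof -
  have "(of_nat n + w) powr (- of_nat s) = 1 / (of_nat n + w) ^ s" for n
  proof -
    have "of_nat n + w \<noteq> 0" using assms by (auto simp: complex_eq_iff)
    then show ?thesis by (simp add: powr_minus powr_nat' divide_inverse)
  qed
  then have "hurwitz_zeta (of_nat s) w = (\<Sum>n. 1 / (of_nat n + w) ^ s)"
    by (simp add: hurwitz_zeta_def)
  then show ?thesis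
    using summable_norm_cancel[OF summable_norm_inverse_power[OF assms]] by (simp add: summable_sums)
qed

text \<open>The subtracted quotient is the integral of (X + s)^(-m-1) over s in [0,1], so the
  difference gains one order. The auxiliary \<open>g\<close> has the expression as its increment
  from X to X + 1, with a derivative bounded by \<open>norm_inverse_power_diff_le\<close>.\<close>

lemma norm_inverse_power_telescope_le:
  fixes w :: complex and n :: nat
  assumes "Re w > 0" "m \<ge> 1"
  defines "X \<equiv> of_nat n + w"
  shows "norm (1 / X ^ (m + 1) - (1 / X ^ m - 1 / (X + 1) ^ m) / of_nat m) \<le> real (m + 1) / norm X ^ (m + 2)"
proof -
  define g where "g = (\<lambda>z. 1 / z ^ m / of_nat m + z / X ^ (m + 1))"
  have "norm (g X - g (X + 1)) \<le> real (m + 1) / norm X ^ (m + 2) * norm (X - (X + 1))"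
  proof (rule field_differentiable_bound[where S = "closed_segment X (X + 1)"])
    fix z assume "z \<in> closed_segment X (X + 1)"
    then obtain \<theta> where \<theta>: "0 \<le> \<theta>" "\<theta> \<le> 1" "z = (1 - \<theta>) *\<^sub>R X + \<theta> *\<^sub>R (X + 1)"
      by (auto simp: closed_segment_def)
    then have z: "z = of_real (real n + \<theta>) + w"
      by (simp add: X_def scaleR_conv_of_real algebra_simps)
    then have "z \<noteq> 0" using \<theta> assms by (auto simp: complex_eq_iff)
    have "(g has_field_derivative (- of_nat m / z ^ (m + 1)) / of_nat m + 1 / X ^ (m + 1)) (at z within closed_segment X (X + 1))"
      unfolding g_def
      by (intro DERIV_add DERIV_cdivide has_field_derivative_inverse_power \<open>z \<noteq> 0\<close> DERIV_ident)
    then show "(g has_field_derivative 1 / X ^ (m + 1) - 1 / z ^ (m + 1)) (at z within closed_segment X (X + 1))"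
      using assms(2) by simp
    show "norm (1 / X ^ (m + 1) - 1 / z ^ (m + 1)) \<le> real (m + 1) / norm X ^ (m + 2)"
      using norm_inverse_power_diff_le[OF assms(1), of "real n" "real n + \<theta>" "m + 1"] \<theta>
      unfolding z X_def by simp
  qed auto
  moreover have "g (X + 1) - g X = 1 / X ^ (m + 1) - (1 / X ^ m - 1 / (X + 1) ^ m) / of_nat m"
    by (simp add: g_def diff_divide_distrib add_divide_distrib)
  moreover have "norm (g X - g (X + 1)) = norm (g (X + 1) - g X)" by (rule norm_minus_commute)
  moreover have "norm (X - (X + 1)) = 1" by simp
  ultimately show ?thesis by (simp only: mult_1_right)
qed

lemma norm_sums_cube_le:
  fixes f :: "nat \<Rightarrow> complex"
  assumes "f sums F" "c \<ge> 1" "u \<ge> 0" "B \<ge> 0"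
    and le: "\<And>n. norm (f n) \<le> B * (1 / norm (of_nat n + cx c u) ^ 3)"
  shows "norm F \<le> B * 8 * (\<Sum>n. (1 + real n) powr (-5/4)) * (1 + u) powr (-7/4)"
proof -
  let ?h = "\<lambda>n. B * 8 * (1 + u) powr (-7/4) * (1 + real n) powr (-5/4)"
  have h: "summable ?h" by (intro summable_mult summable_powr_shift)
  have "norm (f n) \<le> ?h n" for n
    using mult_left_mono[OF norm_inverse_cube_le[OF assms(2,3), of n] assms(4)] le[of n] by (simp add: mult_ac)
  then have "norm (suminf f) \<le> suminf ?h"
    using norm_suminf_le[OF _ h] by blast
  also have "suminf ?h = B * 8 * (1 + u) powr (-7/4) * (\<Sum>n. (1 + real n) powr (-5/4))"
    by (rule suminf_mult[OF summable_powr_shift])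
  finally show ?thesis using assms(1) by (simp add: sums_iff mult_ac)
qed

text \<open>If s >= p + 3, each term is at most |n+w|^(-3). In the critical case s = p + 2 the
  function behaves like 1/((s-1) w), too large in modulus; this leading term is split off and only
  its real part is estimated.\<close>

lemma zeta_decay:
  assumes c: "c \<ge> 1" and ps: "p + 2 \<le> s"
  shows "\<exists>C. \<forall>u\<ge>0. \<bar>Re (cx c u ^ p * hurwitz_zeta (of_nat s) (cx c u))\<bar> \<le> C * (1 + u) powr (-7/4)"
proof -
  let ?S = "\<Sum>n. (1 + real n) powr (-5/4)"
  have norms: "norm (cx c u) \<le> norm (of_nat n + cx c u)" "1 \<le> norm (of_nat n + cx c u)" if "u \<ge> 0" for n u
  proof -
    show "norm (cx c u) \<le> norm (of_nat n + cx c u)" using c by (simp add: cmod_def power_mono)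
    show "1 \<le> norm (of_nat n + cx c u)"
      using complex_Re_le_cmod[of "of_nat n + cx c u"] c by simp
  qed
  show ?thesis
  proof (cases "p + 3 \<le> s")
    case True
    show ?thesis
    proof (intro exI allI impI)
      fix u :: real assume u: "u \<ge> 0"
      let ?w = "cx c u"
      have "norm (?w ^ p * hurwitz_zeta (of_nat s) ?w) \<le> 1 * 8 * ?S * (1 + u) powr (-7/4)"
      proof (rule norm_sums_cube_le[OF _ c u])
        show "(\<lambda>n. ?w ^ p * (1 / (of_nat n + ?w) ^ s)) sums (?w ^ p * hurwitz_zeta (of_nat s) ?w)"
          by (intro sums_mult hurwitz_zeta_sums) (use c ps in auto)
        fix n
        let ?r = "norm (of_nat n + ?w)"
        have "norm (?w ^ p * (1 / (of_nat n + ?w) ^ s)) = norm ?w ^ p * (1 / ?r ^ s)"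
          by (simp add: norm_mult norm_divide norm_power)
        also have "\<dots> \<le> ?r ^ p * (1 / ?r ^ s)"
          by (intro mult_right_mono power_mono norms u) auto
        also have "\<dots> = 1 / ?r ^ (s - p)"
        proof -
          have "?r ^ s = ?r ^ p * ?r ^ (s - p)" using True by (simp flip: power_add)
          moreover have "?r \<noteq> 0" using norms(2)[OF u, of n] by linarith
          ultimately show ?thesis by (simp add: divide_simps)
        qed
        also have "\<dots> \<le> 1 / ?r ^ 3"
          using norms(2)[OF u, of n] True by (intro divide_left_mono power_increasing mult_pos_pos zero_less_power) auto
        finally show "norm (?w ^ p * (1 / (of_nat n + ?w) ^ s)) \<le> 1 * (1 / ?r ^ 3)" by simp
      qed simp
      then show "\<bar>Re (?w ^ p * hurwitz_zeta (of_nat s) ?w)\<bar> \<le> (1 * 8 * ?S) * (1 + u) powr (-7/4)"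
        using abs_Re_le_cmod order_trans by blast
    qed
  next
    case False
    with ps have s: "s = (p + 1) + 1" by simp
    show ?thesis
    proof (intro exI allI impI)
      fix u :: real assume u: "u \<ge> 0"
      let ?w = "cx c u"
      define m where "m = p + 1"
      have w: "Re ?w > 0" using c by simp
      let ?f = "\<lambda>n. ?w ^ p * (1 / (of_nat n + ?w) ^ (m + 1) - (1 / (of_nat n + ?w) ^ m - 1 / (of_nat (Suc n) + ?w) ^ m) / of_nat m)"
      have "norm (?w ^ p * (hurwitz_zeta (of_nat (m + 1)) ?w - (1 / (of_nat 0 + ?w) ^ m - 0) / of_nat m))
          \<le> real (m + 1) * 8 * ?S * (1 + u) powr (-7/4)"
      proof (rule norm_sums_cube_le[OF _ c u])
        have "(\<lambda>n. 1 / (of_nat n + ?w) ^ m) \<longlonglongrightarrow> 0"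
        proof -
          have "filterlim (\<lambda>n. of_nat n + ?w) at_infinity sequentially"
            by (rule tendsto_add_filterlim_at_infinity'[OF tendsto_of_nat tendsto_const])
          then have "(\<lambda>n. 1 / (of_nat n + ?w)) \<longlonglongrightarrow> 0"
            by (rule tendsto_divide_0[OF tendsto_const])
          from tendsto_power[OF this, of m] show ?thesis by (simp add: m_def power_divide)
        qed
        \<comment> \<open>The telescoping series sums to w^(-m)/m, the leading term of zeta(m+1,
          w).\<close>
        from sums_mult[OF sums_diff[OF hurwitz_zeta_sums[OF w] sums_divide[OF telescope_sums'[OF this]]]]
        show "?f sums (?w ^ p * (hurwitz_zeta (of_nat (m + 1)) ?w - (1 / (of_nat 0 + ?w) ^ m - 0) / of_nat m))"
          by (simp only: m_def)
        fix n
        let ?X = "of_nat n + ?w"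
        have "norm (?f n) = norm ?w ^ p * norm (1 / ?X ^ (m + 1) - (1 / ?X ^ m - 1 / (?X + 1) ^ m) / of_nat m)"
          by (simp only: norm_mult norm_power of_nat_Suc ac_simps)
        also have "\<dots> \<le> norm ?X ^ p * (real (m + 1) / norm ?X ^ (m + 2))"
          by (intro mult_mono power_mono norms u norm_inverse_power_telescope_le w) (auto simp: m_def)
        also have "\<dots> = real (m + 1) * (1 / norm ?X ^ 3)"
        proof -
          have "norm ?X ^ (m + 2) = norm ?X ^ p * norm ?X ^ 3"
            by (simp add: m_def power_add power3_eq_cube)
          moreover have "norm ?X \<noteq> 0" using norms(2)[OF u, of n] by linarith
          ultimately show ?thesis by (simp add: divide_simps)
        qed
        finally show "norm (?f n) \<le> real (m + 1) * (1 / norm ?X ^ 3)" .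
      qed simp
      moreover have "?w ^ p * (hurwitz_zeta (of_nat (m + 1)) ?w - (1 / (of_nat 0 + ?w) ^ m - 0) / of_nat m)
        = ?w ^ p * hurwitz_zeta (of_nat s) ?w - of_real (1 / real m) * (1 / ?w)"
      proof -
        have "?w ^ p * (1 / ?w ^ m) = 1 / ?w" using cx_nonzero[of c u] c by (simp add: m_def)
        then have "(?w ^ p * (1 / ?w ^ m)) / of_nat m = of_real (1 / real m) * (1 / ?w)"
          by (simp only: of_real_divide of_real_1 of_real_of_nat_eq) simp
        then have "?w ^ p * ((1 / ?w ^ m) / of_nat m) = of_real (1 / real m) * (1 / ?w)"
          by (simp only: times_divide_eq_right)
        then show ?thesis by (simp only: right_diff_distrib s m_def of_nat_0 add_0 diff_zero)
      qed
      ultimately have "norm (?w ^ p * hurwitz_zeta (of_nat s) ?w - of_real (1 / real m) * (1 / ?w))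
          \<le> real (m + 1) * 8 * ?S * (1 + u) powr (-7/4)" by (simp only:)
      then have "\<bar>Re (?w ^ p * hurwitz_zeta (of_nat s) ?w) - 1 / real m * Re (1 / ?w)\<bar>
          \<le> real (m + 1) * 8 * ?S * (1 + u) powr (-7/4)"
        using abs_Re_le_cmod[of "?w ^ p * hurwitz_zeta (of_nat s) ?w - of_real (1 / real m) * (1 / ?w)"]
        unfolding minus_complex.sel Re_of_real_mult by linarith
      moreover have "\<bar>1 / real m * Re (1 / ?w)\<bar> \<le> c * ((1 + c) / c)^2 * (1 + u) powr (-7/4)"
      proof -
        have "\<bar>1 / real m * Re (1 / ?w)\<bar> \<le> 1 * \<bar>Re (1 / ?w)\<bar>"
          unfolding abs_mult by (intro mult_right_mono) (auto simp: m_def)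
        also have "\<dots> \<le> c * ((1 + c) / c)^2 * (1 / (1 + u)^2)"
          using abs_Re_inverse_cx_le[OF u, of c] c by simp
        also have "\<dots> \<le> c * ((1 + c) / c)^2 * (1 + u) powr (-(7/4))"
          by (intro mult_left_mono powr_bound_of_power2 u) (use c in auto)
        finally show ?thesis by simp
      qed
      moreover have "\<bar>A\<bar> \<le> X + Y" if "\<bar>A - B\<bar> \<le> X" "\<bar>B\<bar> \<le> Y" for A B X Y :: real
        using that by linarith
      ultimately show "\<bar>Re (?w ^ p * hurwitz_zeta (of_nat s) ?w)\<bar>
          \<le> (real (p + 1 + 1) * 8 * ?S + c * ((1 + c) / c)^2) * (1 + u) powr (-7/4)"
        unfolding distrib_right m_def by blast
    qed
  qed
qed

lemma set_integrable_zeta: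
  assumes c: "c \<ge> 1" and ps: "p + 2 \<le> s" and a: "a > 0"
  shows "set_integrable lborel {0..} (\<lambda>u. Re (cx c u ^ p * hurwitz_zeta (of_nat s) (cx c u)) * ln (1 + u^2 / a^2))"
proof -
  obtain C where C: "\<And>u. u \<ge> 0 \<Longrightarrow> \<bar>Re (cx c u ^ p * hurwitz_zeta (of_nat s) (cx c u))\<bar> \<le> C * (1 + u) powr (-7/4)"
    using zeta_decay[OF c ps] by blast
  \<comment> \<open>Measurability is read off the series with integer powers, which avoids complex
    \<open>powr\<close>.\<close>
  have "hurwitz_zeta (of_nat s) (cx c u) = (\<Sum>n. 1 / (of_nat n + cx c u) ^ s)" for u
    using hurwitz_zeta_sums[of "cx c u" s] c ps by (simp add: sums_iff)
  then have "(\<lambda>u. Re (cx c u ^ p * hurwitz_zeta (of_nat s) (cx c u)))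
    = (\<lambda>u. Re (cx c u ^ p * (\<Sum>n. 1 / (of_nat n + cx c u) ^ s)))" by simp
  moreover have "(\<lambda>u. Re (cx c u ^ p * (\<Sum>n. 1 / (of_nat n + cx c u) ^ s))) \<in> borel_measurable borel"
    by measurable
  ultimately have "(\<lambda>u. Re (cx c u ^ p * hurwitz_zeta (of_nat s) (cx c u))) \<in> borel_measurable borel"
    by (simp only:)
  from set_integrable_mult_ln[OF this a C] show ?thesis .
qed

section \<open>Stirling numbers and the collapse of the double sum\<close>

text \<open>The expansion of n(n+1)...(n+K) in unsigned Stirling numbers, divided by n. Since n = 0
  cannot be cancelled, that case is read off the constant term K!.\<close>

lemma stirling_shift_sum:
  "(\<Sum>m\<le>K. of_nat (stirling (Suc K) (Suc m)) * of_nat n ^ m) = (pochhammer (of_nat n + 1) K :: 'a :: field_char_0)"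
proof (cases "n = 0")
  case True
  have "(\<Sum>m\<le>K. of_nat (stirling (Suc K) (Suc m)) * of_nat n ^ m)
     = (\<Sum>m\<in>{0}. of_nat (stirling (Suc K) (Suc m)) * (of_nat n ^ m :: 'a))"
    by (rule sum.mono_neutral_right) (use True in \<open>auto simp: power_0_left\<close>)
  also have "\<dots> = fact K" by (simp add: stirling_Suc_n_1 del: stirling.simps)
  finally show ?thesis using True by (simp add: pochhammer_fact)
next
  case False
  have "of_nat n * (\<Sum>m\<le>K. of_nat (stirling (Suc K) (Suc m)) * (of_nat n ^ m :: 'a))
      = (\<Sum>m\<le>Suc K. of_nat (stirling (Suc K) m) * of_nat n ^ m)"
    by (subst sum.atMost_Suc_shift) (simp add: sum_distrib_left mult_ac del: stirling.simps(4))
  also have "\<dots> = pochhammer (of_nat n) (Suc K)" by (rule stirling_pochhammer)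
  also have "\<dots> = of_nat n * pochhammer (of_nat n + 1) K" by (rule pochhammer_rec)
  finally show ?thesis using False by simp
qed

lemma power_diff_le:
  fixes x y :: real
  assumes "0 \<le> y" "y \<le> x"
  shows "x ^ Suc k - y ^ Suc k \<le> real (Suc k) * (x - y) * x ^ k"
proof (induction k)
  case 0
  then show ?case by simp
next
  case (Suc k)
  have "x ^ Suc (Suc k) - y ^ Suc (Suc k) = x * (x ^ Suc k - y ^ Suc k) + (x - y) * y ^ Suc k"
    by (simp add: algebra_simps)
  also have "\<dots> \<le> x * (real (Suc k) * (x - y) * x ^ k) + (x - y) * x ^ Suc k"
    using assms Suc by (intro add_mono mult_left_mono power_mono) auto
  finally show ?case by (simp add: algebra_simps)
qed

text \<open>Both quantities lie between n^K and (n+K+1)^K. The gap is at most K(K+1) times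
  (n+K+1)^(K-1), and n+K+1 <= (K+1)(n+1).\<close>

lemma pochhammer_minus_power_le:
  assumes K: "K \<ge> 1" and t: "real n \<le> t" "t \<le> real n + 1"
  shows "\<bar>pochhammer (real n + 1) K - t ^ K\<bar> \<le> (real K * (real K + 1) ^ K) * (real n + 1) ^ (K - 1)"
proof -
  let ?M = "real n + real K + 1"
  have "real n ^ K \<le> pochhammer (real n + 1) K" "pochhammer (real n + 1) K \<le> ?M ^ K"
  proof -
    have "(\<Prod>i\<in>{0..<K}. real n) \<le> (\<Prod>i\<in>{0..<K}. real n + 1 + real i)"
      by (intro prod_mono) auto
    then show "real n ^ K \<le> pochhammer (real n + 1) K" by (simp add: pochhammer_prod)
    have "(\<Prod>i\<in>{0..<K}. real n + 1 + real i) \<le> (\<Prod>i\<in>{0..<K}. ?M)"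
      by (intro prod_mono) auto
    then show "pochhammer (real n + 1) K \<le> ?M ^ K" by (simp add: pochhammer_prod)
  qed
  moreover have "real n ^ K \<le> t ^ K" "t ^ K \<le> ?M ^ K"
    using t by (auto intro!: power_mono)
  ultimately have "\<bar>pochhammer (real n + 1) K - t ^ K\<bar> \<le> ?M ^ K - real n ^ K" by linarith
  also have "\<dots> \<le> real K * (?M - real n) * ?M ^ (K - 1)"
    using power_diff_le[of "real n" ?M "K - 1"] K by simp
  also have "\<dots> \<le> real K * (real K + 1) * ((real K + 1) * (real n + 1)) ^ (K - 1)"
  proof (intro mult_mono power_mono)
    have "real K * real n \<ge> 0" by simp
    then show "?M \<le> (real K + 1) * (real n + 1)" unfolding distrib_left distrib_right by linarith
  qed auto
  also have "\<dots> = (real K * (real K + 1) ^ K) * (real n + 1) ^ (K - 1)"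
    using K by (simp add: power_mult_distrib power_eq_if[of _ K])
  finally show ?thesis .
qed

text \<open>The outer sign (-1)^(j+K) and the Stirling sign (-1)^(K-m) multiply to (-1)^(m-j), which
  turns w into -w. Factoring out X^(-K-2) leaves X^j, so for fixed m the sum over j is the binomial
  expansion of (X - w)^m.\<close>

lemma stirling_binomial_collapse:
  fixes X w :: complex
  assumes X: "X \<noteq> 0" and n: "X - w = of_nat n"
  shows "(\<Sum>j=0..K. (-1) ^ (j + K) * (\<Sum>m=j..K. of_nat (m choose j) * of_int (stirling1s (K + 1) (m + 1)) *
            (w ^ (m - j) * (1 / X ^ (K + 2 - j)))))
    = pochhammer (of_nat n + 1) K * (1 / X ^ (K + 2))"
proof -
  have "(\<Sum>j=0..K. (-1) ^ (j + K) * (\<Sum>m=j..K. of_nat (m choose j) * of_int (stirling1s (K + 1) (m + 1)) *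
            (w ^ (m - j) * (1 / X ^ (K + 2 - j)))))
    = (\<Sum>j\<in>{..K}. \<Sum>m | m \<in> {..K} \<and> j \<le> m. of_nat (stirling (Suc K) (Suc m)) *
         (of_nat (m choose j) * X ^ j * (- w) ^ (m - j)) * (1 / X ^ (K + 2)))"
  proof (rule sum.cong)
    fix j assume "j \<in> {..K}"
    then have j: "j \<le> K" by simp
    show "(-1) ^ (j + K) * (\<Sum>m=j..K. of_nat (m choose j) * of_int (stirling1s (K + 1) (m + 1)) *
            (w ^ (m - j) * (1 / X ^ (K + 2 - j))))
      = (\<Sum>m | m \<in> {..K} \<and> j \<le> m. of_nat (stirling (Suc K) (Suc m)) *
         (of_nat (m choose j) * X ^ j * (- w) ^ (m - j)) * (1 / X ^ (K + 2)))"
      unfolding sum_distrib_left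
    proof (rule sum.cong)
      fix m assume "m \<in> {m. m \<in> {..K} \<and> j \<le> m}"
      then have m: "j \<le> m" "m \<le> K" by auto
      have 1: "1 / X ^ (K + 2 - j) = X ^ j * (1 / X ^ (K + 2))"
        using j X by (simp add: field_simps flip: power_add)
      have 2: "(of_int (stirling1s (K + 1) (m + 1)) :: complex) = (-1) ^ (K - m) * of_nat (stirling (Suc K) (Suc m))"
        by (simp add: stirling1s_def del: stirling.simps)
      have 3: "(-1 :: complex) ^ (j + K) * (-1) ^ (K - m) = (-1) ^ (m - j)"
        using m by (auto simp: minus_one_power_iff)
      have 4: "(- w) ^ (m - j) = (-1) ^ (m - j) * w ^ (m - j)" by (rule power_minus)
      have "(-1) ^ (j + K) * (of_nat (m choose j) * of_int (stirling1s (K + 1) (m + 1)) * (w ^ (m - j) * (1 / X ^ (K + 2 - j))))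
        = of_nat (m choose j) * of_nat (stirling (Suc K) (Suc m)) * w ^ (m - j) * X ^ j * (1 / X ^ (K + 2)) * ((-1) ^ (j + K) * (-1) ^ (K - m))"
        unfolding 1 2 by (simp only: mult_ac)
      also have "\<dots> = of_nat (stirling (Suc K) (Suc m)) * (of_nat (m choose j) * X ^ j * (- w) ^ (m - j)) * (1 / X ^ (K + 2))"
        unfolding 3 4 by (simp only: mult_ac)
      finally show "(-1) ^ (j + K) * (of_nat (m choose j) * of_int (stirling1s (K + 1) (m + 1)) * (w ^ (m - j) * (1 / X ^ (K + 2 - j))))
        = of_nat (stirling (Suc K) (Suc m)) * (of_nat (m choose j) * X ^ j * (- w) ^ (m - j)) * (1 / X ^ (K + 2))" .
    qed auto
  qed auto
  also have "\<dots> = (\<Sum>m\<in>{..K}. \<Sum>j | j \<in> {..K} \<and> j \<le> m. of_nat (stirling (Suc K) (Suc m)) *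
         (of_nat (m choose j) * X ^ j * (- w) ^ (m - j)) * (1 / X ^ (K + 2)))"
    by (rule sum.swap_restrict) auto
  also have "\<dots> = (\<Sum>m\<in>{..K}. of_nat (stirling (Suc K) (Suc m)) * of_nat n ^ m * (1 / X ^ (K + 2)))"
  proof (rule sum.cong)
    fix m assume "m \<in> {..K}"
    then have "{j. j \<in> {..K} \<and> j \<le> m} = {..m}" by auto
    moreover have "of_nat n ^ m = (\<Sum>j\<le>m. of_nat (m choose j) * X ^ j * (- w) ^ (m - j))"
      using binomial_ring[of X "- w" m] n by simp
    ultimately show "(\<Sum>j | j \<in> {..K} \<and> j \<le> m. of_nat (stirling (Suc K) (Suc m)) *
         (of_nat (m choose j) * X ^ j * (- w) ^ (m - j)) * (1 / X ^ (K + 2)))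
      = of_nat (stirling (Suc K) (Suc m)) * of_nat n ^ m * (1 / X ^ (K + 2))"
      by (simp only: sum_distrib_left sum_distrib_right)
  qed auto
  also have "\<dots> = pochhammer (of_nat n + 1) K * (1 / X ^ (K + 2))"
    by (simp only: stirling_shift_sum flip: sum_distrib_right)
  finally show ?thesis .
qed

text \<open>A finite combination of convergent series may be formed termwise; j <= K keeps every
  zeta argument at least 2.\<close>

lemma zeta_combination:
  assumes c: "c > 0"
  shows "(\<Sum>j=0..K. (-1) ^ (j + K) * (\<Sum>m=j..K. real (m choose j) * of_int (stirling1s (K + 1) (m + 1)) *
            Re (cx c u ^ (m - j) * hurwitz_zeta (of_nat (K + 2 - j)) (cx c u))))
    = (\<Sum>n. pochhammer (real n + 1) K * Re (1 / cx (real n + c) u ^ (K + 2)))"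
proof -
  define w where "w = cx c u"
  have w: "Re w > 0" using c by (simp add: w_def)
  have "(\<lambda>n. \<Sum>j=0..K. (-1) ^ (j + K) * (\<Sum>m=j..K. of_nat (m choose j) * of_int (stirling1s (K + 1) (m + 1)) *
            (w ^ (m - j) * (1 / (of_nat n + w) ^ (K + 2 - j)))))
    sums (\<Sum>j=0..K. (-1) ^ (j + K) * (\<Sum>m=j..K. of_nat (m choose j) * of_int (stirling1s (K + 1) (m + 1)) *
            (w ^ (m - j) * hurwitz_zeta (of_nat (K + 2 - j)) w)))"
    by (intro sums_sum sums_mult hurwitz_zeta_sums w) auto
  moreover have "(\<Sum>j=0..K. (-1) ^ (j + K) * (\<Sum>m=j..K. of_nat (m choose j) * of_int (stirling1s (K + 1) (m + 1)) *
            (w ^ (m - j) * (1 / (of_nat n + w) ^ (K + 2 - j)))))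
    = of_real (pochhammer (real n + 1) K) * (1 / cx (real n + c) u ^ (K + 2))" for n
  proof -
    have "of_nat n + w \<noteq> 0" using w by (auto simp: complex_eq_iff)
    moreover have "of_real (pochhammer (real n + 1) K) = (pochhammer (of_nat n + 1) K :: complex)"
      by (simp flip: pochhammer_of_real)
    moreover have "cx (real n + c) u = of_nat n + w" by (simp add: w_def)
    ultimately show ?thesis
      using stirling_binomial_collapse[of "of_nat n + w" w n K] by (simp only: add_diff_cancel_right' not_False_eq_True simp_thms)
  qed
  ultimately have "(\<lambda>n. of_real (pochhammer (real n + 1) K) * (1 / cx (real n + c) u ^ (K + 2)))
    sums (\<Sum>j=0..K. (-1) ^ (j + K) * (\<Sum>m=j..K. of_nat (m choose j) * of_int (stirling1s (K + 1) (m + 1)) *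
            (w ^ (m - j) * hurwitz_zeta (of_nat (K + 2 - j)) w)))"
    by (simp only:)
  then have "(\<lambda>n. Re (of_real (pochhammer (real n + 1) K) * (1 / cx (real n + c) u ^ (K + 2))))
    sums Re (\<Sum>j=0..K. (-1) ^ (j + K) * (\<Sum>m=j..K. of_nat (m choose j) * of_int (stirling1s (K + 1) (m + 1)) *
            (w ^ (m - j) * hurwitz_zeta (of_nat (K + 2 - j)) w)))"
    by (simp only: sums_complex_iff)
  moreover have "Re (\<Sum>j=0..K. (-1) ^ (j + K) * (\<Sum>m=j..K. of_nat (m choose j) * of_int (stirling1s (K + 1) (m + 1)) *
            (w ^ (m - j) * hurwitz_zeta (of_nat (K + 2 - j)) w)))
    = (\<Sum>j=0..K. (-1) ^ (j + K) * (\<Sum>m=j..K. real (m choose j) * of_int (stirling1s (K + 1) (m + 1)) *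
            Re (w ^ (m - j) * hurwitz_zeta (of_nat (K + 2 - j)) w)))"
  proof -
    have *: "Re ((-1) ^ i * z) = (-1) ^ i * Re z" for i z
      using Re_of_real_mult[of "(-1) ^ i" z] by simp
    have **: "Re (of_nat i * of_int k * z) = real i * of_int k * Re z" for i k z
      using Re_of_real_mult[of "real i * of_int k" z] by simp
    show ?thesis by (simp only: Re_sum * **)
  qed
  ultimately show ?thesis unfolding w_def Re_of_real_mult by (simp only: sums_iff)
qed

section \<open>Both identities from one statement in K and c\<close>

text \<open>The sign (-1)^(j+K) covers both (-1)^(j-1) for odd K and (-1)^j for even K. The
  parameter \<open>l\<close> is kept apart from \<open>c\<close> because the digamma argument is x -
  l in both cases.\<close>

theorem zeta_log_integral_combination:
  fixes x c :: real
  assumes c: "c \<ge> 1" and K: "K \<ge> 1" and x: "x > c" and l: "l \<le> K" "x > real l"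
  shows "(\<Sum>j=0..K. (-1) ^ (j + K) * (\<Sum>m=j..K. real (m choose j) * of_int (stirling1s (K + 1) (m + 1)) *
      (2 * integral {0..} (\<lambda>u. Re (cx c u ^ (m - j) * hurwitz_zeta (of_nat (K + 2 - j)) (cx c u)) * ln (1 + u^2 / (x - c)^2)))))
    = - (2 * pi / real (K + 1)) * (ln (x - c) + harm K
        - (deriv ^^ K) (\<lambda>t. ((t - 1) gchoose K) * Digamma (t - real l)) x)"
proof -
  define a where "a = x - c"
  have a: "a > 0" using x by (simp add: a_def)
  let ?D = "(deriv ^^ K) (\<lambda>t. ((t - 1) gchoose K) * Digamma (t - real l)) x"
  let ?I = "\<lambda>j m u. Re (cx c u ^ (m - j) * hurwitz_zeta (of_nat (K + 2 - j)) (cx c u))"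
  let ?L = "\<lambda>u::real. ln (1 + u^2 / a^2)"
  have "(\<lambda>N. - (ln (real N) - (\<Sum>n<N. pochhammer (real n + 1) K / (real n + x) ^ (K + 1)))) \<longlonglongrightarrow> - ?D"
    by (intro tendsto_minus higher_deriv_gbinomial_Digamma l)
  then have "(\<lambda>N. (\<Sum>n<N. pochhammer (real n + 1) K / (real n + c + a) ^ (K + 1)) - ln (real N)) \<longlonglongrightarrow> - ?D"
    by (simp add: a_def)
  from has_halfline_integral_series_mult_ln[OF c K a _ pochhammer_minus_power_le[OF K] this]
  have main: "has_halfline_integral (\<lambda>u. (\<Sum>n. pochhammer (real n + 1) K * Re (1 / cx (real n + c) u ^ (K + 2))) * ?L u)
      (- (pi / real (K + 1)) * (ln a + harm K + - ?D))"
    by simp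
  \<comment> \<open>The condition \<open>p + 2 \<le> s\<close> of \<open>set_integrable_zeta\<close>
    reads m <= K here, with the critical case exactly at m = K.\<close>
  have "has_halfline_integral (\<lambda>u. \<Sum>j=0..K. (-1) ^ (j + K) * (\<Sum>m=j..K. real (m choose j) * of_int (stirling1s (K + 1) (m + 1)) * (?I j m u * ?L u)))
    (\<Sum>j=0..K. (-1) ^ (j + K) * (\<Sum>m=j..K. real (m choose j) * of_int (stirling1s (K + 1) (m + 1)) * integral {0..} (\<lambda>u. ?I j m u * ?L u)))"
    by (intro has_halfline_integral_sum has_halfline_integral_cmult has_halfline_integral_integral set_integrable_zeta c a) auto
  moreover have "(\<Sum>j=0..K. (-1) ^ (j + K) * (\<Sum>m=j..K. real (m choose j) * of_int (stirling1s (K + 1) (m + 1)) * (?I j m u * ?L u)))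
    = (\<Sum>n. pochhammer (real n + 1) K * Re (1 / cx (real n + c) u ^ (K + 2))) * ?L u" for u
  proof -
    have "c > 0" using c by simp
    show ?thesis
      by (simp only: zeta_combination[OF \<open>c > 0\<close>, symmetric] sum_distrib_right mult.assoc)
  qed
  ultimately have "has_halfline_integral (\<lambda>u. (\<Sum>n. pochhammer (real n + 1) K * Re (1 / cx (real n + c) u ^ (K + 2))) * ?L u)
    (\<Sum>j=0..K. (-1) ^ (j + K) * (\<Sum>m=j..K. real (m choose j) * of_int (stirling1s (K + 1) (m + 1)) * integral {0..} (\<lambda>u. ?I j m u * ?L u)))"
    by (simp only:)
  from has_halfline_integral_unique[OF this main]
  have eq: "(\<Sum>j=0..K. (-1) ^ (j + K) * (\<Sum>m=j..K. real (m choose j) * of_int (stirling1s (K + 1) (m + 1)) * integral {0..} (\<lambda>u. ?I j m u * ?L u)))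
    = - (pi / real (K + 1)) * (ln a + harm K + - ?D)" .
  have "(\<Sum>j=0..K. (-1) ^ (j + K) * (\<Sum>m=j..K. real (m choose j) * of_int (stirling1s (K + 1) (m + 1)) * (2 * integral {0..} (\<lambda>u. ?I j m u * ?L u))))
    = 2 * (\<Sum>j=0..K. (-1) ^ (j + K) * (\<Sum>m=j..K. real (m choose j) * of_int (stirling1s (K + 1) (m + 1)) * integral {0..} (\<lambda>u. ?I j m u * ?L u)))"
    by (simp only: sum_distrib_left mult.left_commute[of _ 2])
  also have "\<dots> = - (2 * pi / real (K + 1)) * (ln a + harm K - ?D)"
    unfolding eq by (simp del: of_nat_Suc)
  finally show ?thesis unfolding a_def .
qed

theorem theorem7p3:
  fixes l :: nat
  assumes "l > 0"
  shows "(\<forall>x::real. x > real l \<longrightarrow>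
      (\<Sum>j = 0..2*l-1. (-1) powi (int j - 1) *
         (\<Sum>m = j..2*l-1. real (m choose j) * of_int (stirling1s (2*l) (m+1)) * zl l m j x))
      = - (pi / real l) * (ln (x - real l) + harm (2*l-1)
          - (deriv ^^ (2*l-1)) (\<lambda>t. ((t - 1) gchoose (2*l-1)) * Digamma (t - real l)) x)) \<and>
    (\<forall>x::real. x > real l + 1/2 \<longrightarrow>
      (\<Sum>j = 0..2*l. (-1) ^ j *
         (\<Sum>m = j..2*l. real (m choose j) * of_int (stirling1s (2*l+1) (m+1)) * Zl l m j x))
      = - (2 * pi / (2 * real l + 1)) * (ln (x - real l - 1/2) + harm (2*l)
          - (deriv ^^ (2*l)) (\<lambda>t. ((t - 1) gchoose (2*l)) * Digamma (t - real l)) x))"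
proof (intro conjI allI impI)
  fix x :: real assume x: "x > real l"
  have 1: "2 * l - 1 + 1 = 2 * l" "2 * l - 1 + 2 - j = 2 * l + 1 - j" for j using assms by auto
  \<comment> \<open>At j = 0 the exponent is -1, hence the integer power; the parities agree because
    2l - 1 is odd.\<close>
  have sign: "(-1 :: real) powi (int j - 1) = (-1) ^ (j + (2 * l - 1))" for j
  proof -
    have "(-1 :: real) powi (int j - 1) = (-1) ^ Suc j"
      by (simp add: power_int_diff)
    also have "\<dots> = (-1) ^ (j + (2 * l - 1))"
      using assms by (simp add: minus_one_power_iff)
    finally show ?thesis .
  qed
  have c: "2 * pi / real (2 * l) = pi / real l" by simp
  have w: "complex_of_nat l = complex_of_real (real l)" by simp
  have "real l \<ge> 1" "2 * l - 1 \<ge> 1" "l \<le> 2 * l - 1" using assms by auto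
  from zeta_log_integral_combination[OF this(1,2) x this(3) x]
  show "(\<Sum>j = 0..2*l-1. (-1) powi (int j - 1) *
         (\<Sum>m = j..2*l-1. real (m choose j) * of_int (stirling1s (2*l) (m+1)) * zl l m j x))
      = - (pi / real l) * (ln (x - real l) + harm (2*l-1)
          - (deriv ^^ (2*l-1)) (\<lambda>t. ((t - 1) gchoose (2*l-1)) * Digamma (t - real l)) x)"
    unfolding zl_def sign w 1 c .
next
  fix x :: real assume x: "x > real l + 1/2"
  have sign: "(-1 :: real) ^ (j + 2 * l) = (-1) ^ j" for j by (simp add: power_add power_mult)
  have c: "real (2 * l + 1) = 2 * real l + 1" by simp
  have "real l + 1/2 \<ge> 1" "2 * l \<ge> 1" "l \<le> 2 * l" "x > real l" using assms x by auto
  from zeta_log_integral_combination[OF this(1,2) x this(3,4)]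
  show "(\<Sum>j = 0..2*l. (-1) ^ j *
         (\<Sum>m = j..2*l. real (m choose j) * of_int (stirling1s (2*l+1) (m+1)) * Zl l m j x))
      = - (2 * pi / (2 * real l + 1)) * (ln (x - real l - 1/2) + harm (2*l)
          - (deriv ^^ (2*l)) (\<lambda>t. ((t - 1) gchoose (2*l)) * Digamma (t - real l)) x)"
    unfolding Zl_def sign c diff_diff_eq .
qed

end
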